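(* For every $\theta\in(0,\pi/2]$ and all integers $g\ge 3$ and $k\ge 1$, there is a collection $\mathcal{C}$ of circles in the plane, no two of which are concentric, such that the $\theta$-graph $G_\theta(\mathcal{C})$ has girth at least $g$ and chromatic number at least $k$.
   Context: Two intersecting circles $C_1,C_2$ intersect at angle $\theta$ if at any intersection point of $C_1$ and $C_2$, the (smaller) angle between the tangent line to $C_1$ and the tangent line to $C_2$ equals $\theta$. For $\theta\in[0,\pi/2]$, the $\theta$-graph $G_\theta(\mathcal{C})$ of a collection of circles $\mathcal{C}$ is the graph with vertex set $\mathcal{C}$ whose edges are the pairs of circles in $\mathcal{C}$ that intersect at angle $\theta$. The girth of a graph is the minimum length of a cycle in it. *)

theory Defs
  imports "HOL-Analysis.Analysis" "HOL-Library.Extended_Nat"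
begin

section \<open>Graphs, girth and chromatic number\<close>

text \<open>A graph is a pair of a vertex set and a set of two-element sets of vertices.\<close>

type_synonym 'a graph = "'a set \<times> 'a set set"

definition is_cycle :: "'a graph \<Rightarrow> 'a list \<Rightarrow> bool" where
  "is_cycle G vs \<longleftrightarrow> length vs \<ge> 3 \<and> distinct vs \<and> set vs \<subseteq> fst G \<and>
     (\<forall>i < length vs. {vs ! i, vs ! (Suc i mod length vs)} \<in> snd G)"

text \<open>The girth of an acyclic graph is \<open>\<infinity>\<close>, the infimum of the empty set.\<close>

definition girth :: "'a graph \<Rightarrow> enat" where
  "girth G = Inf {enat (length vs) | vs. is_cycle G vs}"

definition is_proper_colouring :: "'a graph \<Rightarrow> nat \<Rightarrow> ('a \<Rightarrow> nat) \<Rightarrow> bool" where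
  "is_proper_colouring G n f \<longleftrightarrow> (\<forall>v \<in> fst G. f v < n) \<and>
     (\<forall>v \<in> fst G. \<forall>w \<in> fst G. {v, w} \<in> snd G \<longrightarrow> f v \<noteq> f w)"

text \<open>A graph without a proper colouring in finitely many colours has chromatic number \<open>\<infinity>\<close>.\<close>

definition chromatic_number :: "'a graph \<Rightarrow> enat" where
  "chromatic_number G = Inf {enat n | n. \<exists>f. is_proper_colouring G n f}"


section \<open>Circles in the plane and their angle of intersection\<close>

type_synonym plane = "real ^ 2"

definition is_circle :: "plane set \<Rightarrow> bool" where
  "is_circle C \<longleftrightarrow> (\<exists>c r. r > 0 \<and> C = sphere c r)"

definition centre :: "plane set \<Rightarrow> plane" where
  "centre C = (THE c. \<exists>r > 0. C = sphere c r)"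

lemma centre_sphere:
  assumes "r > 0"
  shows "centre (sphere c r) = c"
  unfolding centre_def
proof (rule the_equality)
  show "\<exists>s > 0. sphere c r = sphere c s" using assms by blast
next
  fix d assume "\<exists>s > 0. sphere c r = sphere d s"
  then obtain s where s: "s > 0" "sphere c r = sphere d s" by blast
  show "d = c"
  proof (rule ccontr)
    assume "d \<noteq> c"
    then have n: "norm (c - d) > 0" by simp
    define u where "u = (c - d) /\<^sub>R norm (c - d)"
    have u: "norm u = 1" "c - d = norm (c - d) *\<^sub>R u" using n by (auto simp: u_def)
    have "c + r *\<^sub>R u \<in> sphere d s"
      using u(1) assms s(2) by (auto simp: dist_norm)
    moreover have "c + r *\<^sub>R u - d = (norm (c - d) + r) *\<^sub>R u"
      using u(2) by (simp add: algebra_simps)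
    ultimately have 1: "s = norm (c - d) + r"
      using u(1) n assms by (simp add: dist_norm norm_minus_commute[of d])
    have "d - s *\<^sub>R u \<in> sphere c r"
      using u(1) s by (auto simp: dist_norm)
    moreover have "c - (d - s *\<^sub>R u) = (norm (c - d) + s) *\<^sub>R u"
      using u(2) by (simp add: algebra_simps)
    ultimately have "r = norm (c - d) + s"
      using u(1) n s(1) by (auto simp: dist_norm)
    with 1 n show False by simp
  qed
qed

definition concentric :: "plane set \<Rightarrow> plane set \<Rightarrow> bool" where
  "concentric C D \<longleftrightarrow> centre C = centre D"

text \<open>The line through \<open>p\<close> perpendicular to the radius at \<open>p\<close>; only meaningful if \<open>p\<close> lies on the
  circle \<open>C\<close>.\<close>

definition tangent_line :: "plane set \<Rightarrow> plane \<Rightarrow> plane set" where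
  "tangent_line C p = {x. (x - p) \<bullet> (p - centre C) = 0}"

definition vector_angle :: "plane \<Rightarrow> plane \<Rightarrow> real" where
  "vector_angle u v = arccos (u \<bullet> v / (norm u * norm v))"

text \<open>For lines \<open>L\<close> and \<open>M\<close>, the angle between a direction vector of \<open>L\<close> and one of \<open>M\<close> takes only two
  values, \<open>\<phi>\<close> and \<open>\<pi> - \<phi>\<close>, so this infimum is the smaller of the two angles between the lines.\<close>

definition line_angle :: "plane set \<Rightarrow> plane set \<Rightarrow> real" where
  "line_angle L M = Inf {vector_angle (b - a) (d - c) | a b c d.
     a \<in> L \<and> b \<in> L \<and> a \<noteq> b \<and> c \<in> M \<and> d \<in> M \<and> c \<noteq> d}"

definition intersect_at_angle :: "real \<Rightarrow> plane set \<Rightarrow> plane set \<Rightarrow> bool" where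
  "intersect_at_angle \<theta> C D \<longleftrightarrow> C \<inter> D \<noteq> {} \<and>
     (\<forall>p \<in> C \<inter> D. line_angle (tangent_line C p) (tangent_line D p) = \<theta>)"

definition theta_graph :: "real \<Rightarrow> plane set set \<Rightarrow> plane set graph" where
  "theta_graph \<theta> \<C> =
     (\<C>, {{C, D} | C D. C \<in> \<C> \<and> D \<in> \<C> \<and> C \<noteq> D \<and> intersect_at_angle \<theta> C D})"

end

theory Submission
  imports Defs
begin

text \<open>
  The proof is by induction on the chromatic number, realising Tutte's construction geometrically.
  Fix a direction \<open>u\<close>. A circle with centre \<open>c\<close> and radius \<open>r\<close> meets a line \<open>u \<bullet> x = y\<close> at angle
  \<open>\<theta>\<close> iff \<open>y = u \<bullet> c \<plusminus> r cos \<theta>\<close>. Given a family of circles whose graph is not \<open>k\<close>-colourable, let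
  \<open>T\<close> be the set of the values \<open>u \<bullet> c + r cos \<theta>\<close>. Take a finite set of homotheties of the real line
  such that every \<open>(k + 1)\<close>-colouring is constant on one of the copies of \<open>T\<close>, while
  the copies form a hypergraph without short cycles. Draw the lines \<open>u \<bullet> x = y\<close> for all \<open>y\<close> in these
  copies, and for every homothety the corresponding homothetic copy of the circles, different
  copies being far apart. In a \<open>(k + 1)\<close>-colouring some copy of \<open>T\<close> is monochromatic, so one colour
  is missing on the corresponding copy of the circles, a contradiction. Inversion in a generic
  point turns the lines into circles and preserves angles.

  The sparse Ramsey family comes from the Hales--Jewett theorem by partite amalgamation, each
  round of which raises the bound on the length of the excluded cycles.
  The absence of short cycles is expressed by leaves: every nonempty set of at most \<open>m\<close> edges
  contains an edge that meets the union of the others in at most one vertex.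
\<close>

section \<open>Sparse hypergraphs\<close>

text \<open>Edges are indexed, so two indices with the same vertex set count as two edges. For m
  \<ge> 2 any two edges share at most one vertex, so hypergraph cycles of length two are excluded as
  well.\<close>

definition sparse :: "nat \<Rightarrow> ('i \<Rightarrow> 'v set) \<Rightarrow> 'i set \<Rightarrow> bool" where
  "sparse m A I \<longleftrightarrow> (\<forall>J \<subseteq> I. J \<noteq> {} \<and> finite J \<and> card J \<le> m \<longrightarrow>
     (\<exists>j \<in> J. \<exists>z. A j \<inter> (\<Union>i \<in> J - {j}. A i) \<subseteq> {z}))"

lemma sparseD:
  assumes "sparse m A I" "J \<subseteq> I" "J \<noteq> {}" "finite J" "card J \<le> m"
  obtains j z where "j \<in> J" "A j \<inter> (\<Union>i \<in> J - {j}. A i) \<subseteq> {z}"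
  using assms(1)[unfolded sparse_def, rule_format, of J] assms(2-) that by metis

lemma sparse_one: "sparse 1 A I"
  unfolding sparse_def
proof (intro allI impI)
  fix J assume "J \<subseteq> I" "J \<noteq> {} \<and> finite J \<and> card J \<le> 1"
  then obtain j where "J = {j}"
    by (metis One_nat_def card_1_singletonE card_gt_0_iff le_antisym Suc_leI)
  then show "\<exists>j \<in> J. \<exists>z. A j \<inter> (\<Union>i \<in> J - {j}. A i) \<subseteq> {z}" by simp
qed

text \<open>A leaf j fails only if x lies on j and on no other edge. Then the induction runs on the
  remaining edges with the point where j is attached as the new marked point: the leaf found there
  avoids x and meets j at most in that point.\<close>

lemma sparse_pointed_leaf:
  assumes sp: "sparse m A I" and "J \<subseteq> I" "J \<noteq> {}" "finite J" "card J \<le> m"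
  shows "\<exists>j \<in> J. \<exists>z. A j \<inter> insert x (\<Union>i \<in> J - {j}. A i) \<subseteq> {z}"
  using assms(2-)
proof (induction "card J" arbitrary: J x rule: less_induct)
  case less
  obtain j a where j: "j \<in> J" and a: "A j \<inter> (\<Union>i \<in> J - {j}. A i) \<subseteq> {a}"
    using sparseD[OF sp less.prems] by blast
  show ?case
  proof (cases "A j \<inter> insert x (\<Union>i \<in> J - {j}. A i) \<subseteq> {a} \<or> A j \<inter> (\<Union>i \<in> J - {j}. A i) = {}")
    case True
    then show ?thesis using j by (elim disjE) blast+
  next
    case False
    then have x: "x \<in> A j" "x \<notin> (\<Union>i \<in> J - {j}. A i)" and ne: "J - {j} \<noteq> {}"
      using a by blast+
    have "card (J - {j}) < card J" using j less.prems by (simp add: card_gt_0_iff)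
    then obtain i z where i: "i \<in> J - {j}" and z: "A i \<inter> insert a (\<Union>l \<in> J - {j} - {i}. A l) \<subseteq> {z}"
      using less.hyps[of "J - {j}" a] ne less.prems by fastforce
    have "A i \<inter> A j \<subseteq> {a}" "x \<notin> A i" using a x i by blast+
    then have "A i \<inter> insert x (\<Union>l \<in> J - {i}. A l) \<subseteq> {z}" using z by blast
    then show ?thesis using i by blast
  qed
qed

section \<open>The Hales--Jewett theorem\<close>

text \<open>Combinatorial lines are encoded as lists in which \<open>None\<close> marks the moving
  coordinates. \<open>templates\<close> also contains the lists without \<open>None\<close>;
  \<open>line_mono\<close> rules them out.\<close>

definition inst :: "'a option list \<Rightarrow> 'a \<Rightarrow> 'a list" where
  "inst L a = map (case_option a id) L"

definition templates :: "'a set \<Rightarrow> nat \<Rightarrow> 'a option list set" where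
  "templates A n = {L. length L = n \<and> set L \<subseteq> insert None (Some ` A)}"

definition words :: "'a set \<Rightarrow> nat \<Rightarrow> 'a list set" where
  "words A n = {w. length w = n \<and> set w \<subseteq> A}"

lemma inst_append [simp]: "inst (L @ M) a = inst L a @ inst M a"
  by (simp add: inst_def)

lemma inst_Some [simp]: "inst (map Some w) a = w"
  by (induction w) (auto simp: inst_def)

lemma inst_words:
  assumes "L \<in> templates A n" "a \<in> B" "A \<subseteq> B"
  shows "inst L a \<in> words B n"
proof -
  have "case_option a id z \<in> B" if "z \<in> set L" for z
  proof -
    have "z \<in> insert None (Some ` A)" using assms(1) that by (auto simp: templates_def)
    then show ?thesis using assms(2,3) by auto
  qed
  then show ?thesis using assms(1) by (auto simp: inst_def templates_def words_def)
qed

lemma templates_append: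
  "L \<in> templates A n \<Longrightarrow> M \<in> templates A m \<Longrightarrow> L @ M \<in> templates A (n + m)"
  by (auto simp: templates_def)

lemma templates_mono: "A \<subseteq> B \<Longrightarrow> L \<in> templates A n \<Longrightarrow> L \<in> templates B n"
  unfolding templates_def by blast

lemma map_Some_templates: "w \<in> words A n \<Longrightarrow> map Some w \<in> templates A n"
  by (auto simp: templates_def words_def)

lemma finite_words: "finite A \<Longrightarrow> finite (words A n)"
  unfolding words_def using finite_lists_length_eq[of A n] by (simp add: conj_commute)

definition line_mono :: "('a list \<Rightarrow> nat) \<Rightarrow> 'a set \<Rightarrow> 'a option list \<Rightarrow> nat \<Rightarrow> bool" where
  "line_mono c A L \<kappa> \<longleftrightarrow> None \<in> set L \<and> (\<forall>a \<in> A. c (inst L a) = \<kappa>)"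

text \<open>Colour focusing: as long as there is no monochromatic line, there are lines that are
  monochromatic on \<open>B\<close> in \<open>s\<close> different colours and meet in one point at the letter \<open>b\<close>.\<close>

lemma hales_jewett_focus:
  fixes B :: "'a set" and b :: 'a
  assumes fin: "finite B" and ne: "B \<noteq> {}"
    and HJ: "\<And>r. \<exists>n. \<forall>c. (\<forall>w. c w < r) \<longrightarrow> (\<exists>L \<in> templates B n. \<exists>\<kappa>. line_mono c B L \<kappa>)"
  defines "A \<equiv> insert b B"
  shows "\<exists>n. \<forall>c. (\<forall>w. c w < r) \<longrightarrow> (\<exists>L \<in> templates A n. \<exists>\<kappa>. line_mono c A L \<kappa>) \<or>
     (\<exists>f \<in> words A n. \<exists>K. finite K \<and> card K = s \<and>
        (\<forall>\<kappa> \<in> K. \<exists>L \<in> templates A n. inst L b = f \<and> line_mono c B L \<kappa>))"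
proof (induction s)
  case 0
  show ?case by (rule exI[of _ 0]) (auto simp: words_def intro!: exI[of _ "{}"])
next
  case (Suc s)
  then obtain n where n: "\<And>c. \<forall>w. c w < r \<Longrightarrow> (\<exists>L \<in> templates A n. \<exists>\<kappa>. line_mono c A L \<kappa>) \<or>
     (\<exists>f \<in> words A n. \<exists>K. finite K \<and> card K = s \<and>
        (\<forall>\<kappa> \<in> K. \<exists>L \<in> templates A n. inst L b = f \<and> line_mono c B L \<kappa>))" by blast
  define W where "W = words A n"
  have "finite W" using fin by (simp add: W_def A_def finite_words)
  \<comment> \<open>A word v in the last m coordinates is coloured by the whole map taking u to
    \<open>c (u @ v)\<close>; there are finitely many such maps, and \<open>enc\<close> numbers
    them.\<close>
  define P where "P = (W \<rightarrow>\<^sub>E {..<r})"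
  have "finite P" using \<open>finite W\<close> by (simp add: P_def finite_PiE)
  then obtain enc where enc: "bij_betw enc P {0..<card P}"
    using ex_bij_betw_finite_nat by blast
  obtain m where m: "\<And>c. \<forall>w. c w < card P \<Longrightarrow> \<exists>L \<in> templates B m. \<exists>\<kappa>. line_mono c B L \<kappa>"
    using HJ by blast
  show ?case
  proof (intro exI[of _ "n + m"] allI impI)
    fix c :: "'a list \<Rightarrow> nat" assume c: "\<forall>w. c w < r"
    have inP: "restrict (\<lambda>u. c (u @ v)) W \<in> P" for v using c by (auto simp: P_def)
    then have "\<forall>v. enc (restrict (\<lambda>u. c (u @ v)) W) < card P"
      using enc by (auto simp: bij_betw_def)
    from m[OF this] obtain L \<kappa>' where L: "L \<in> templates B m" "None \<in> set L"
      and \<kappa>': "\<And>a. a \<in> B \<Longrightarrow> enc (restrict (\<lambda>u. c (u @ inst L a)) W) = \<kappa>'"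
      by (auto simp: line_mono_def)
    have LA: "L \<in> templates A m" using L(1) by (rule templates_mono[rotated]) (auto simp: A_def)
    have same: "c (u @ inst L a) = c (u @ inst L a')" if "u \<in> W" "a \<in> B" "a' \<in> B" for u a a'
    proof -
      have "restrict (\<lambda>u. c (u @ inst L a)) W = restrict (\<lambda>u. c (u @ inst L a')) W"
        using enc inP \<kappa>' that by (metis bij_betw_imp_inj_on inj_onD)
      then show ?thesis using that by (metis restrict_apply')
    qed
    \<comment> \<open>The colour of \<open>u @ inst L a\<close> does not depend on the letter a of
      B, so one fixed suffix represents them all and the case s applies to the prefixes.\<close>
    obtain a0 where a0: "a0 \<in> B" using ne by blast
    define v0 where "v0 = inst L a0"
    have v0: "v0 \<in> words A m"
      unfolding v0_def by (rule inst_words[OF LA]) (use a0 in \<open>auto simp: A_def\<close>)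
    define c1 where "c1 u = c (u @ v0)" for u
    have c1: "\<forall>w. c1 w < r" using c by (simp add: c1_def)
    have lift: "\<exists>L \<in> templates A (n + m). \<exists>\<kappa>. line_mono c A L \<kappa>"
      if "M \<in> templates A n" "line_mono c1 A M \<kappa>" for M \<kappa>
    proof
      show "M @ map Some v0 \<in> templates A (n + m)"
        using that(1) map_Some_templates[OF v0] by (rule templates_append)
      show "\<exists>\<kappa>. line_mono c A (M @ map Some v0) \<kappa>"
        using that(2) by (auto simp: line_mono_def c1_def intro!: exI[of _ \<kappa>])
    qed
    show "(\<exists>L \<in> templates A (n + m). \<exists>\<kappa>. line_mono c A L \<kappa>) \<or>
     (\<exists>f \<in> words A (n + m). \<exists>K. finite K \<and> card K = Suc s \<and>
        (\<forall>\<kappa> \<in> K. \<exists>L \<in> templates A (n + m). inst L b = f \<and> line_mono c B L \<kappa>))"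
    proof (cases "\<exists>L \<in> templates A n. \<exists>\<kappa>. line_mono c1 A L \<kappa>")
      case True
      then show ?thesis using lift by blast
    next
      case no_line: False
      then obtain f K where f: "f \<in> words A n" and K: "finite K" "card K = s"
        and KL: "\<And>\<kappa>. \<kappa> \<in> K \<Longrightarrow> \<exists>L \<in> templates A n. inst L b = f \<and> line_mono c1 B L \<kappa>"
        using n[OF c1] by blast
      \<comment> \<open>A focused line of colour \<open>c1 f\<close> would keep its colour at the
        letter b and so be monochromatic on A.\<close>
      have new: "c1 f \<notin> K"
      proof
        assume "c1 f \<in> K"
        from KL[OF this] obtain M where "M \<in> templates A n" "inst M b = f" "line_mono c1 B M (c1 f)"
          by blast
        then have "line_mono c1 A M (c1 f)" by (auto simp: line_mono_def A_def)
        then show False using no_line \<open>M \<in> templates A n\<close> by blast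
      qed
      \<comment> \<open>The old lines now move in both blocks, while the line of the new colour
        keeps the prefix f and moves in the second block only. All of them reach
        \<open>f @ inst L b\<close> at the letter b.\<close>
      have "\<exists>L' \<in> templates A (n + m). inst L' b = f @ inst L b \<and> line_mono c B L' \<kappa>"
        if \<kappa>: "\<kappa> \<in> insert (c1 f) K" for \<kappa>
      proof (cases "\<kappa> = c1 f")
        case True
        have "line_mono c B (map Some f @ L) \<kappa>"
          using L(2) same[OF f[folded W_def] _ a0] by (simp add: line_mono_def True c1_def v0_def)
        then show ?thesis using templates_append[OF map_Some_templates[OF f] LA]
          by (intro bexI[of _ "map Some f @ L"]) auto
      next
        case False
        then obtain M where M: "M \<in> templates A n" "inst M b = f" "line_mono c1 B M \<kappa>"
          using KL \<kappa> by blast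
        have "c (inst M a @ inst L a) = \<kappa>" if "a \<in> B" for a
        proof -
          have "inst M a \<in> W" unfolding W_def
            by (rule inst_words[OF M(1)]) (use that in \<open>auto simp: A_def\<close>)
          then show ?thesis using same[OF _ that a0] that M(3)
            by (simp add: line_mono_def c1_def v0_def)
        qed
        then have "line_mono c B (M @ L) \<kappa>" using L(2) by (auto simp: line_mono_def)
        then show ?thesis using templates_append[OF M(1) LA] M(2)
          by (intro bexI[of _ "M @ L"]) auto
      qed
      moreover have "f @ inst L b \<in> words A (n + m)"
        using f inst_words[OF LA, of b A] by (auto simp: A_def words_def)
      moreover have "finite (insert (c1 f) K)" "card (insert (c1 f) K) = Suc s"
        using K new by auto
      ultimately show ?thesis by blast
    qed
  qed
qed

theorem hales_jewett:
  assumes "finite A"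
  shows "\<exists>n. \<forall>c. (\<forall>w. c w < r) \<longrightarrow> (\<exists>L \<in> templates A n. \<exists>\<kappa>. line_mono c A L \<kappa>)"
proof (cases "A = {}")
  case True
  have "[None] \<in> templates A 1" by (simp add: templates_def)
  moreover have "line_mono c A [None] 0" for c
    by (simp add: line_mono_def True)
  ultimately show ?thesis by blast
next
  case False
  with assms show ?thesis
  proof (induction A arbitrary: r rule: finite_ne_induct)
    case (singleton x)
    have "[None] \<in> templates {x} 1" by (simp add: templates_def)
    moreover have "line_mono c {x} [None] (c (inst [None] x))" for c
      by (simp add: line_mono_def)
    ultimately show ?case by blast
  next
    case (insert b B)
    from hales_jewett_focus[OF insert.hyps(1,2) insert.IH, where s = "Suc r" and r = r]
    obtain n where n: "\<forall>c. (\<forall>w. c w < r) \<longrightarrow>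
      (\<exists>L \<in> templates (insert b B) n. \<exists>\<kappa>. line_mono c (insert b B) L \<kappa>) \<or>
      (\<exists>f \<in> words (insert b B) n. \<exists>K. finite K \<and> card K = Suc r \<and>
        (\<forall>\<kappa> \<in> K. \<exists>L \<in> templates (insert b B) n. inst L b = f \<and> line_mono c B L \<kappa>))" ..
    show ?case
    proof (intro exI[of _ n] allI impI)
      fix c :: "'a list \<Rightarrow> nat" assume c: "\<forall>w. c w < r"
      \<comment> \<open>As B is nonempty, each colour in K is a value of c, so \<open>Suc r\<close>
        focused colours cannot occur and only a monochromatic line remains.\<close>
      have "\<not> card K = Suc r"
        if "\<forall>\<kappa> \<in> K. \<exists>L \<in> templates (insert b B) n. inst L b = f \<and> line_mono c B L \<kappa>" for K f
      proof -
        have "K \<subseteq> {..<r}" using that c insert.hyps(2) by (fastforce simp: line_mono_def)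
        then show ?thesis using card_mono[of "{..<r}" K] by auto
      qed
      then show "\<exists>L \<in> templates (insert b B) n. \<exists>\<kappa>. line_mono c (insert b B) L \<kappa>"
        using n[rule_format, of c] c by blast
    qed
  qed
qed

section \<open>Sparse Ramsey families of homotheties\<close>

definition homothety :: "real \<times> real \<Rightarrow> real \<Rightarrow> real" where
  "homothety h x = fst h * x + snd h"

definition ramsey_family :: "nat \<Rightarrow> real set \<Rightarrow> (real \<times> real) set \<Rightarrow> bool" where
  "ramsey_family r T \<Lambda> \<longleftrightarrow>
     (\<forall>c. (\<forall>x. c x < r) \<longrightarrow> (\<exists>h \<in> \<Lambda>. \<exists>\<kappa>::nat. \<forall>t \<in> T. c (homothety h t) = \<kappa>))"

text \<open>In the application the points of Q outside T are second heights at which a circle is met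
  at angle \<theta>; a line at such a height would create unwanted edges. Q stays arbitrary because
  the amalgamation passes to a larger set.\<close>

definition generic_family :: "real set \<Rightarrow> real set \<Rightarrow> (real \<times> real) set \<Rightarrow> bool" where
  "generic_family T Q \<Lambda> \<longleftrightarrow> finite \<Lambda> \<and> (\<forall>h \<in> \<Lambda>. fst h > 0) \<and>
     (\<forall>h \<in> \<Lambda>. \<forall>h' \<in> \<Lambda>. \<forall>q \<in> Q. \<forall>q' \<in> Q. homothety h q = homothety h' q' \<longrightarrow>
        h = h' \<or> q \<in> T \<and> q' \<in> T)"

lemma generic_familyD:
  assumes "generic_family T Q \<Lambda>"
  shows "finite \<Lambda>" "\<And>h. h \<in> \<Lambda> \<Longrightarrow> fst h > 0"
    "\<And>h h' q q'. \<lbrakk>h \<in> \<Lambda>; h' \<in> \<Lambda>; q \<in> Q; q' \<in> Q; homothety h q = homothety h' q'\<rbrakk> \<Longrightarrow>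
       h = h' \<or> q \<in> T \<and> q' \<in> T"
  using assms unfolding generic_family_def by meson+

lemma homothety_inj: "fst h > 0 \<Longrightarrow> homothety h x = homothety h y \<longleftrightarrow> x = y"
  by (simp add: homothety_def)

definition homothety_comp :: "real \<times> real \<Rightarrow> real \<times> real \<Rightarrow> real \<times> real" where
  "homothety_comp h e = (fst h * fst e, fst h * snd e + snd h)"

lemma homothety_comp [simp]: "homothety (homothety_comp h e) x = homothety h (homothety e x)"
  by (simp add: homothety_def homothety_comp_def algebra_simps)

section \<open>Words as numbers in base M, combinatorial lines as homotheties\<close>

definition word_value :: "real \<Rightarrow> real list \<Rightarrow> real" where
  "word_value M w = foldr (\<lambda>a s. a + M * s) w 0"

lemma word_value_simps [simp]:
  "word_value M [] = 0" "word_value M (a # w) = a + M * word_value M w"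
  by (simp_all add: word_value_def)

lemma finite_separation:
  fixes Q :: "real set"
  assumes "finite Q"
  obtains \<delta> where "\<delta> > 0" "\<And>x y. x \<in> Q \<Longrightarrow> y \<in> Q \<Longrightarrow> x \<noteq> y \<Longrightarrow> \<bar>x - y\<bar> \<ge> \<delta>"
proof -
  define D where "D = (\<lambda>(x, y). \<bar>x - y\<bar>) ` (Q \<times> Q) - {0}"
  have "finite D" using assms by (simp add: D_def)
  define \<delta> where "\<delta> = Min (insert 1 D)"
  have "\<delta> > 0" using \<open>finite D\<close> by (auto simp: \<delta>_def D_def)
  moreover have "\<bar>x - y\<bar> \<ge> \<delta>" if "x \<in> Q" "y \<in> Q" "x \<noteq> y" for x y
    unfolding \<delta>_def using \<open>finite D\<close> that by (intro Min_le) (force simp: D_def)+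
  ultimately show thesis by (rule that)
qed

lemma word_value_inj:
  fixes Q :: "real set"
  assumes "finite Q"
  obtains M where "M > 0" "\<And>n. inj_on (word_value M) (words Q n)"
proof -
  obtain \<delta> where \<delta>: "\<delta> > 0" "\<And>x y. x \<in> Q \<Longrightarrow> y \<in> Q \<Longrightarrow> x \<noteq> y \<Longrightarrow> \<bar>x - y\<bar> \<ge> \<delta>"
    using finite_separation[OF assms] by metis
  obtain D where D: "\<And>x. x \<in> Q \<Longrightarrow> \<bar>x\<bar> \<le> D"
    using finite_imp_bounded[OF assms] unfolding bounded_iff by auto
  \<comment> \<open>This gives \<open>M * \<delta> = \<delta> + 2 * |D|\<close>, so a gap of at
    least \<delta> between the tails outweighs any difference of the first letters and leaves at
    least \<delta>.\<close>
  define M where "M = 1 + 2 * \<bar>D\<bar> / \<delta>"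
  have "M > 0" using \<delta>(1) by (simp add: M_def add_pos_nonneg)
  have sep: "\<bar>word_value M u - word_value M v\<bar> \<ge> \<delta>"
    if "u \<in> words Q n" "v \<in> words Q n" "u \<noteq> v" for u v n
    using that
  proof (induction n arbitrary: u v)
    case 0
    then show ?case by (simp add: words_def)
  next
    case (Suc n)
    then obtain a u' b v' where uv: "u = a # u'" "v = b # v'"
      by (auto simp: words_def length_Suc_conv)
    then have mem: "a \<in> Q" "b \<in> Q" "u' \<in> words Q n" "v' \<in> words Q n"
      using Suc.prems by (auto simp: words_def)
    show ?case
    proof (cases "u' = v'")
      case True
      then show ?thesis using Suc.prems uv \<delta>(2)[of a b] mem by auto
    next
      case False
      define s where "s = word_value M u' - word_value M v'"
      have "\<bar>s\<bar> \<ge> \<delta>" unfolding s_def using Suc.IH False mem by blast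
      then have "\<bar>M * s\<bar> \<ge> M * \<delta>" using \<open>M > 0\<close> by (simp add: abs_mult)
      moreover have "M * \<delta> = \<delta> + 2 * \<bar>D\<bar>" using \<delta>(1) by (simp add: M_def field_simps)
      moreover have "\<bar>a - b\<bar> \<le> 2 * \<bar>D\<bar>" using D[of a] D[of b] mem by linarith
      moreover have "word_value M u - word_value M v = (a - b) + M * s"
        by (simp add: uv s_def algebra_simps)
      ultimately show ?thesis by linarith
    qed
  qed
  have "inj_on (word_value M) (words Q n)" for n
  proof (rule inj_onI)
    fix u v assume "u \<in> words Q n" "v \<in> words Q n" "word_value M u = word_value M v"
    then show "u = v" using sep[of u n v] \<delta>(1) by force
  qed
  then show thesis using \<open>M > 0\<close> by (rule that[rotated])
qed

text \<open>The value of \<open>inst L q\<close> is affine in the letter q. The slope is the value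
  of the 0-1 word marking the moving coordinates, and the shift is the value at q = 0.\<close>

definition line_homothety :: "real \<Rightarrow> real option list \<Rightarrow> real \<times> real" where
  "line_homothety M L = (word_value M (map (\<lambda>z. if z = None then 1 else 0) L),
     word_value M (inst L 0))"

lemma homothety_line: "homothety (line_homothety M L) q = word_value M (inst L q)"
proof (induction L)
  case (Cons z L)
  have "word_value M (inst (z # L) q) = case_option q id z + M * homothety (line_homothety M L) q"
    using Cons by (simp add: inst_def)
  then show ?case
    by (cases z) (simp_all add: homothety_def line_homothety_def inst_def algebra_simps)
qed (simp add: homothety_def line_homothety_def inst_def)

lemma line_homothety_pos:
  assumes "M > 0" "None \<in> set L"
  shows "fst (line_homothety M L) > 0"
proof -
  have nonneg: "word_value M (map (\<lambda>z. if z = None then 1 else 0) L) \<ge> 0" for L :: "real option list"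
    using assms(1) by (induction L) auto
  show ?thesis using assms(2)
  proof (induction L)
    case (Cons z L)
    then show ?case using assms(1) nonneg[of L]
      by (cases z) (auto simp: line_homothety_def add_pos_nonneg)
  qed simp
qed

text \<open>A letter outside \<open>T\<close> can only come from the variable positions, so it shows the template.\<close>

lemma inst_eq_outside:
  assumes L: "L \<in> templates T n" "None \<in> set L" and L': "L' \<in> templates T n"
    and eq: "inst L q = inst L' q'" and q: "q \<notin> T"
  shows "L = L'"
proof (rule nth_equalityI)
  show len: "length L = length L'" using L(1) L' by (simp add: templates_def)
  have nth: "case_option q id (L ! i) = case_option q' id (L' ! i)" if "i < length L" for i
    using arg_cong[OF eq, of "\<lambda>w. w ! i"] that len by (simp add: inst_def)
  have mem: "L ! i = None \<or> L ! i \<in> Some ` T" "L' ! i = None \<or> L' ! i \<in> Some ` T"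
    if "i < length L" for i
  proof -
    have "L ! i \<in> insert None (Some ` T)" "L' ! i \<in> insert None (Some ` T)"
      using L(1) L' that len unfolding templates_def mem_Collect_eq by (metis nth_mem subsetD)+
    then show "L ! i = None \<or> L ! i \<in> Some ` T" "L' ! i = None \<or> L' ! i \<in> Some ` T"
      by blast+
  qed
  have none: "L' ! i = None \<and> q' = q" if "i < length L" "L ! i = None" for i
    using nth[OF that(1)] mem(2)[OF that(1)] that(2) q by auto
  obtain i0 where "i0 < length L" "L ! i0 = None" using L(2) by (auto simp: in_set_conv_nth)
  then have q': "q' = q" using none by blast
  show "L ! i = L' ! i" if i: "i < length L" for i
    using nth[OF i] mem[OF i] none[OF i] q unfolding q' by auto
qed

text \<open>The Hales-Jewett theorem for the alphabet T, read in base M. Injectivity is taken on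
  words over Q, because lines must be compared also at letters outside T: equal values force equal
  words, and a letter outside T reveals the template.\<close>

lemma ramsey_family_exists:
  assumes "finite Q" "T \<subseteq> Q"
  obtains \<Lambda> where "ramsey_family r T \<Lambda>" "generic_family T Q \<Lambda>"
proof -
  have T: "finite T" using assms finite_subset by blast
  obtain M where M: "M > 0" "\<And>n. inj_on (word_value M) (words Q n)"
    using word_value_inj[OF assms(1)] by blast
  obtain n where n: "\<And>c. \<forall>w. c w < r \<Longrightarrow> \<exists>L \<in> templates T n. \<exists>\<kappa>. line_mono c T L \<kappa>"
    using hales_jewett[OF T] by blast
  define LL where "LL = {L \<in> templates T n. None \<in> set L}"
  define \<Lambda> where "\<Lambda> = line_homothety M ` LL"
  have "templates T n = words (insert None (Some ` T)) n"
    by (auto simp: templates_def words_def)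
  then have "finite LL" using T by (simp add: LL_def finite_words)
  have "ramsey_family r T \<Lambda>"
    unfolding ramsey_family_def
  proof (intro allI impI)
    fix c :: "real \<Rightarrow> nat" assume "\<forall>x. c x < r"
    then have "\<forall>w. (c \<circ> word_value M) w < r" by simp
    from n[OF this] show "\<exists>h \<in> \<Lambda>. \<exists>\<kappa>. \<forall>t \<in> T. c (homothety h t) = \<kappa>"
      unfolding line_mono_def \<Lambda>_def LL_def by (auto simp: homothety_line)
  qed
  moreover have "generic_family T Q \<Lambda>"
    unfolding generic_family_def
  proof (intro conjI ballI impI)
    show "finite \<Lambda>" using \<open>finite LL\<close> by (simp add: \<Lambda>_def)
    show "fst h > 0" if "h \<in> \<Lambda>" for h
      using that line_homothety_pos[OF M(1)] by (auto simp: \<Lambda>_def LL_def)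
    fix h h' q q' assume "h \<in> \<Lambda>" "h' \<in> \<Lambda>" and q: "q \<in> Q" "q' \<in> Q"
      and eq: "homothety h q = homothety h' q'"
    then obtain L L' where L: "L \<in> LL" "h = line_homothety M L"
      and L': "L' \<in> LL" "h' = line_homothety M L'" by (auto simp: \<Lambda>_def)
    have "inst L q = inst L' q'"
    proof (rule inj_onD[OF M(2)])
      show "inst L q \<in> words Q n" "inst L' q' \<in> words Q n"
        using L(1) L'(1) q assms(2) by (auto simp: LL_def intro: inst_words)
    qed (use eq L L' in \<open>simp add: homothety_line\<close>)
    then show "h = h' \<or> q \<in> T \<and> q' \<in> T"
      using inst_eq_outside[of L T n L' q q'] inst_eq_outside[of L' T n L q' q] L L'
      by (auto simp: LL_def)
  qed
  ultimately show thesis by (rule that)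
qed

section \<open>Partite amalgamation\<close>

text \<open>\<open>\<pi>\<close> projects the copies \<open>e\<close> of \<open>T\<close> onto the base copies \<open>h \<in> \<Lambda>\<close>. The fibres over \<open>Y\<close> have been
  processed: on suitable representatives of the base copies, a colouring depends there only
  on the projection.\<close>

definition partite_system ::
  "nat \<Rightarrow> real set \<Rightarrow> (real \<times> real) set \<Rightarrow> real set \<Rightarrow> (real \<times> real) set \<Rightarrow> (real \<Rightarrow> real) \<Rightarrow> bool" where
  "partite_system r T \<Lambda> Y E \<pi> \<longleftrightarrow>
     (\<forall>e \<in> E. \<exists>h \<in> \<Lambda>. \<forall>t \<in> T. \<pi> (homothety e t) = homothety h t) \<and>
     (\<forall>c. (\<forall>x. c x < r) \<longrightarrow> (\<exists>\<xi>::real \<Rightarrow> nat. (\<forall>x. \<xi> x < r) \<and>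
        (\<forall>h \<in> \<Lambda>. \<exists>e \<in> E. \<forall>t \<in> T. \<pi> (homothety e t) = homothety h t \<and>
           (homothety h t \<in> Y \<longrightarrow> c (homothety e t) = \<xi> (homothety h t)))))"

lemma partite_systemD:
  assumes "partite_system r T \<Lambda> Y E \<pi>"
  shows "\<And>e. e \<in> E \<Longrightarrow> \<exists>h \<in> \<Lambda>. \<forall>t \<in> T. \<pi> (homothety e t) = homothety h t"
    "\<And>c. \<forall>x. c x < r \<Longrightarrow> \<exists>\<xi>::real \<Rightarrow> nat. (\<forall>x. \<xi> x < r) \<and>
        (\<forall>h \<in> \<Lambda>. \<exists>e \<in> E. \<forall>t \<in> T. \<pi> (homothety e t) = homothety h t \<and>
           (homothety h t \<in> Y \<longrightarrow> c (homothety e t) = \<xi> (homothety h t)))"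
  using assms unfolding partite_system_def by simp_all

text \<open>The copies are pairwise disjoint translates of T, one for each h in \<Lambda>; the
  projection remembers h, not the shape of the copy. Disjointness makes every edge a leaf, and with
  no fibre processed any \<xi> with values below r will do.\<close>

lemma partite_system_base:
  assumes Q: "finite Q" "T \<subseteq> Q" and fin: "finite \<Lambda>"
  shows "\<exists>E \<pi>. generic_family T Q E \<and> sparse m (\<lambda>e. homothety e ` T) E \<and>
    partite_system r T \<Lambda> {} E \<pi>"
proof -
  obtain idx :: "real \<times> real \<Rightarrow> nat" where idx: "inj_on idx \<Lambda>"
    using finite_imp_inj_to_nat_seg[OF fin] by blast
  obtain D where D: "\<And>x. x \<in> Q \<Longrightarrow> \<bar>x\<bar> \<le> D"
    using finite_imp_bounded[OF Q(1)] unfolding bounded_iff by auto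
  \<comment> \<open>Larger than the diameter of Q, so translates of Q by distinct integer multiples
    of K are disjoint.\<close>
  define K where "K = 1 + 2 * \<bar>D\<bar>"
  have K: "K > 0" by (simp add: K_def)
  have apart: "i = i' \<and> q = q'"
    if "q \<in> Q" "q' \<in> Q" and eq: "q + K * real i = q' + K * real i'" for q q' i i'
  proof -
    have "i = i'"
    proof (rule ccontr)
      assume "i \<noteq> i'"
      then have "\<bar>real i - real i'\<bar> \<ge> 1" by linarith
      then have "K * \<bar>real i - real i'\<bar> \<ge> K" using K by simp
      moreover have "q' - q = K * (real i - real i')" using eq by (simp add: algebra_simps)
      then have "\<bar>q' - q\<bar> = K * \<bar>real i - real i'\<bar>" using K by (simp add: abs_mult)
      moreover have "\<bar>q' - q\<bar> \<le> 2 * \<bar>D\<bar>" using D[OF that(1)] D[OF that(2)] by linarith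
      ultimately show False by (simp add: K_def)
    qed
    then show ?thesis using eq by simp
  qed
  define sh where "sh h = (1::real, K * real (idx h))" for h
  have sh: "homothety (sh h) x = x + K * real (idx h)" for h x
    by (simp add: sh_def homothety_def)
  define \<pi> where "\<pi> y = (SOME z. \<exists>h \<in> \<Lambda>. \<exists>t \<in> T. y = homothety (sh h) t \<and> z = homothety h t)" for y
  have \<pi>: "\<pi> (homothety (sh h) t) = homothety h t" if "h \<in> \<Lambda>" "t \<in> T" for h t
  proof -
    have "\<exists>h' \<in> \<Lambda>. \<exists>t' \<in> T. homothety (sh h) t = homothety (sh h') t' \<and>
        \<pi> (homothety (sh h) t) = homothety h' t'"
      unfolding \<pi>_def by (rule someI_ex) (use that in blast)
    then obtain h' t' where h': "h' \<in> \<Lambda>" "t' \<in> T" "homothety (sh h) t = homothety (sh h') t'"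
      "\<pi> (homothety (sh h) t) = homothety h' t'" by blast
    then have "idx h = idx h' \<and> t = t'"
      using apart[of t t' "idx h" "idx h'"] that Q(2) by (auto simp: sh)
    then show ?thesis using h' inj_onD[OF idx] that by metis
  qed
  define E where "E = sh ` \<Lambda>"
  have same: "e = e'" if e: "e \<in> E" "e' \<in> E" and q: "q \<in> Q" "q' \<in> Q"
    and eq: "homothety e q = homothety e' q'" for e e' q q'
  proof -
    obtain h h' where "e = sh h" "e' = sh h'" using e by (auto simp: E_def)
    then show ?thesis using apart[OF q, of "idx h" "idx h'"] eq by (simp add: sh) (simp add: sh_def)
  qed
  have "generic_family T Q E"
    unfolding generic_family_def using fin same by (auto simp: E_def sh_def)
  moreover have "sparse m (\<lambda>e. homothety e ` T) E"
    unfolding sparse_def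
  proof (intro allI impI)
    fix J assume J: "J \<subseteq> E" "J \<noteq> {} \<and> finite J \<and> card J \<le> m"
    then obtain j where j: "j \<in> J" by blast
    have "homothety j ` T \<inter> homothety i ` T = {}" if "i \<in> J - {j}" for i
      using same[of j i] that j J(1) Q(2) by blast
    then show "\<exists>j \<in> J. \<exists>z. homothety j ` T \<inter> (\<Union>i \<in> J - {j}. homothety i ` T) \<subseteq> {z}"
      using j by blast
  qed
  moreover have "partite_system r T \<Lambda> {} E \<pi>"
    unfolding partite_system_def E_def using \<pi> by blast
  ultimately show ?thesis by blast
qed

lemma card_ge_twice:
  assumes "finite J" and "\<And>h. h \<in> f ` J \<Longrightarrow> card {j \<in> J. f j = h} \<noteq> 1"
  shows "2 * card (f ` J) \<le> card J"
proof -
  have "card J = (\<Sum>h \<in> f ` J. card {j \<in> J. f j = h})"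
    using sum.image_gen[OF assms(1), of "\<lambda>_. 1::nat" f] by simp
  moreover have "card {j \<in> J. f j = h} \<ge> 2" if "h \<in> f ` J" for h
  proof -
    have "card {j \<in> J. f j = h} \<noteq> 0" using that assms(1) by auto
    then show ?thesis using assms(2)[OF that] by linarith
  qed
  then have "(\<Sum>h \<in> f ` J. card {j \<in> J. f j = h}) \<ge> (\<Sum>h \<in> f ` J. 2)"
    by (rule sum_mono)
  ultimately show ?thesis by simp
qed

text \<open>Different copies meet only inside \<open>F\<close>, which every edge meets at most once. So either
  some copy contributes a single edge, which is a leaf, or at most half as many copies as
  edges occur and a leaf among the copies contains a leaf among the edges.\<close>

lemma sparse_amalgam:
  fixes E \<Lambda> :: "(real \<times> real) set"
  assumes m: "m \<ge> 1"
    and E: "sparse (Suc m) (\<lambda>e. homothety e ` T) E"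
    and edge: "\<And>e. e \<in> E \<Longrightarrow> homothety e ` T \<subseteq> P \<and> (\<exists>a. homothety e ` T \<inter> F \<subseteq> {a})"
    and \<Lambda>: "sparse m (\<lambda>h. homothety h ` F) \<Lambda>"
    and pos: "\<And>h. h \<in> \<Lambda> \<Longrightarrow> fst h > 0"
    and meet: "\<And>h h' q q'. \<lbrakk>h \<in> \<Lambda>; h' \<in> \<Lambda>; q \<in> P; q' \<in> P; homothety h q = homothety h' q'\<rbrakk> \<Longrightarrow>
       h = h' \<or> q \<in> F \<and> q' \<in> F"
  shows "sparse (Suc m) (\<lambda>e. homothety e ` T) ((\<lambda>(h, e). homothety_comp h e) ` (\<Lambda> \<times> E))"
  unfolding sparse_def
proof (intro allI impI)
  let ?A = "\<lambda>e. homothety e ` T"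
  fix J assume JE: "J \<subseteq> (\<lambda>(h, e). homothety_comp h e) ` (\<Lambda> \<times> E)"
    and "J \<noteq> {} \<and> finite J \<and> card J \<le> Suc m"
  then have J: "J \<noteq> {}" "finite J" "card J \<le> Suc m" by auto
  have "\<forall>j \<in> J. \<exists>p. p \<in> \<Lambda> \<times> E \<and> j = homothety_comp (fst p) (snd p)"
    using JE by fastforce
  then obtain p where p: "\<And>j. j \<in> J \<Longrightarrow> p j \<in> \<Lambda> \<times> E \<and> j = homothety_comp (fst (p j)) (snd (p j))"
    by metis
  define hh ee where "hh j = fst (p j)" and "ee j = snd (p j)" for j
  have hh: "hh j \<in> \<Lambda>" and ee: "ee j \<in> E" and comp: "j = homothety_comp (hh j) (ee j)"
    if "j \<in> J" for j
    using p[OF that] by (auto simp: hh_def ee_def mem_Times_iff)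
  have im: "?A j = homothety (hh j) ` ?A (ee j)" if "j \<in> J" for j
    by (subst comp[OF that]) (auto simp: image_image)
  have cross: "x \<in> homothety (hh j) ` (?A (ee j) \<inter> F) \<and> x \<in> homothety (hh i) ` F"
    if ij: "i \<in> J" "j \<in> J" "hh i \<noteq> hh j" and x: "x \<in> ?A j" "x \<in> ?A i" for i j x
  proof -
    obtain q q' where q: "q \<in> ?A (ee j)" "x = homothety (hh j) q"
      "q' \<in> ?A (ee i)" "x = homothety (hh i) q'"
      using x unfolding im[OF ij(1)] im[OF ij(2)] by blast
    then have "q \<in> P" "q' \<in> P" using edge[OF ee] ij(1,2) by blast+
    then have "q \<in> F \<and> q' \<in> F" using meet[of "hh j" "hh i" q q'] hh ij q by metis
    then show ?thesis using q by blast
  qed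
  show "\<exists>j \<in> J. \<exists>z. ?A j \<inter> (\<Union>i \<in> J - {j}. ?A i) \<subseteq> {z}"
  proof (cases "\<exists>h \<in> hh ` J. card {j \<in> J. hh j = h} = 1")
    case True
    then obtain h j where j: "{i \<in> J. hh i = h} = {j}" by (metis (no_types, lifting) card_1_singletonE)
    have "j \<in> {i \<in> J. hh i = h}" unfolding j by simp
    then have jJ: "j \<in> J" and "hh j = h" by simp_all
    then have only: "hh i \<noteq> hh j" if "i \<in> J - {j}" for i
      using that j by (metis (mono_tags, lifting) DiffE mem_Collect_eq)
    obtain a where a: "?A (ee j) \<inter> F \<subseteq> {a}" using edge[OF ee[OF jJ]] by blast
    have "?A j \<inter> (\<Union>i \<in> J - {j}. ?A i) \<subseteq> homothety (hh j) ` (?A (ee j) \<inter> F)"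
      using cross[OF _ jJ] only by blast
    also have "\<dots> \<subseteq> {homothety (hh j) a}" using a by blast
    finally show ?thesis using jJ by blast
  next
    case False
    \<comment> \<open>At most (m + 1) / 2 \<le> m copies occur, so order m suffices for the copies,
      while the edges inside one copy use order \<open>Suc m\<close>.\<close>
    then have "2 * card (hh ` J) \<le> card J" by (intro card_ge_twice[OF J(2)]) metis
    then have "card (hh ` J) \<le> m" using J(3) m by linarith
    moreover have "hh ` J \<subseteq> \<Lambda>" using hh by blast
    moreover have "hh ` J \<noteq> {}" "finite (hh ` J)" using J by simp_all
    ultimately obtain h z where h: "h \<in> hh ` J"
      and z: "homothety h ` F \<inter> (\<Union>i \<in> hh ` J - {h}. homothety i ` F) \<subseteq> {z}"
      using sparseD[OF \<Lambda>, of "hh ` J"] by metis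
    define G where "G = {j \<in> J. hh j = h}"
    have G: "G \<noteq> {}" "finite G" "G \<subseteq> J" using h J by (auto simp: G_def)
    have inj: "inj_on ee G"
    proof (rule inj_onI)
      fix i j assume "i \<in> G" "j \<in> G" "ee i = ee j"
      then show "i = j" using comp[of i] comp[of j] by (simp add: G_def)
    qed
    have cardG: "card (ee ` G) \<le> Suc m"
      using card_image_le[OF G(2), of ee] card_mono[OF J(2) G(3)] J(3) by linarith
    have "h \<in> \<Lambda>" using h hh by blast
    \<comment> \<open>The point that h sends to z. Only there can F in this copy meet F in the other
      copies occurring in J, so it is marked when a leaf is chosen inside the copy.\<close>
    define y where "y = (z - snd h) / fst h"
    have y: "homothety h q = z \<longleftrightarrow> q = y" for q
      using pos[OF \<open>h \<in> \<Lambda>\<close>] by (auto simp: y_def homothety_def field_simps)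
    have "ee ` G \<subseteq> E" using ee G(3) by blast
    moreover have "ee ` G \<noteq> {}" "finite (ee ` G)" using G by simp_all
    ultimately obtain e a where e: "e \<in> ee ` G"
      and a: "?A e \<inter> insert y (\<Union>i \<in> ee ` G - {e}. ?A i) \<subseteq> {a}"
      using sparse_pointed_leaf[OF E _ _ _ cardG, of y] by metis
    then obtain j where j: "j \<in> G" "e = ee j" by blast
    then have jJ: "j \<in> J" and hj: "hh j = h" by (auto simp: G_def)
    have "?A j \<inter> ?A i \<subseteq> {homothety h a}" if i: "i \<in> J - {j}" for i
    proof
      fix x assume x: "x \<in> ?A j \<inter> ?A i"
      show "x \<in> {homothety h a}"
      proof (cases "hh i = h")
        case True
        then have "i \<in> G" using i by (simp add: G_def)
        then have ie: "ee i \<in> ee ` G - {e}" using inj j i by (auto dest: inj_onD)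
        have "x \<in> homothety h ` ?A (ee j)" "x \<in> homothety h ` ?A (ee i)"
          using x im[OF jJ] im[of i] i True hj by simp_all
        then obtain q q' where q: "q \<in> ?A (ee j)" "x = homothety h q"
          "q' \<in> ?A (ee i)" "x = homothety h q'" unfolding image_iff[of x] by blast
        then have "q = q'" using homothety_inj[OF pos[OF \<open>h \<in> \<Lambda>\<close>]] by metis
        then have "q \<in> {a}" using a q ie j(2) by blast
        then show ?thesis using q by simp
      next
        case False
        have iJ: "i \<in> J" "x \<in> ?A j" "x \<in> ?A i" using i x by blast+
        have "hh i \<noteq> hh j" using False hj by simp
        from cross[OF iJ(1) jJ this iJ(2,3)]
        obtain q where q: "q \<in> ?A e" "q \<in> F" "x = homothety h q" "x \<in> homothety (hh i) ` F"
          using hj j(2) by blast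
        have "hh i \<in> hh ` J - {h}" using iJ(1) False by blast
        with z q have "x = z" by blast
        then have "q = y" using y q(3) by simp
        then have "q = a" using a q(1) by blast
        then show ?thesis using q(3) by simp
      qed
    qed
    then show ?thesis using jJ by blast
  qed
qed

text \<open>The fibre F over x is made monochromatic by a Ramsey family for F alone, each member of
  which carries a copy of the whole system. In the copy where F has the single colour \<kappa>, the
  old system handles Y, and \<kappa> becomes the value of \<xi> at x. A copy of T meets F at most
  once, as the projection is injective on it; this lets \<open>sparse_amalgam\<close> keep the order
  \<open>Suc m\<close> although \<Lambda> has only order m.\<close>

lemma partite_system_step:
  assumes Q: "finite Q" "T \<subseteq> Q" and m: "m \<ge> 1" and \<Lambda>0: "\<And>h. h \<in> \<Lambda>0 \<Longrightarrow> fst h > 0"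
    and IH: "\<And>F Q. finite Q \<Longrightarrow> F \<subseteq> Q \<Longrightarrow>
      \<exists>\<Lambda>. ramsey_family r F \<Lambda> \<and> generic_family F Q \<Lambda> \<and> sparse m (\<lambda>h. homothety h ` F) \<Lambda>"
    and gen: "generic_family T Q E" and sp: "sparse (Suc m) (\<lambda>e. homothety e ` T) E"
    and par: "partite_system r T \<Lambda>0 Y E \<pi>"
  shows "\<exists>E \<pi>. generic_family T Q E \<and> sparse (Suc m) (\<lambda>e. homothety e ` T) E \<and>
    partite_system r T \<Lambda>0 (insert x Y) E \<pi>"
proof -
  define P where "P = (\<Union>e \<in> E. homothety e ` T)"
  \<comment> \<open>Genericity is asked for all of R, not only for P, so that points of copies of Q
    outside T stay apart as well.\<close>
  define R where "R = (\<Union>e \<in> E. homothety e ` Q)"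
  define F where "F = {p \<in> P. \<pi> p = x}"
  note gen' = generic_familyD[OF gen]
  have "finite R" "P \<subseteq> R" using gen'(1) Q by (auto simp: P_def R_def)
  have "F \<subseteq> P" by (auto simp: F_def)
  obtain \<Lambda> where ram: "ramsey_family r F \<Lambda>" and gen\<Lambda>: "generic_family F R \<Lambda>"
    and sp\<Lambda>: "sparse m (\<lambda>h. homothety h ` F) \<Lambda>"
    using IH[OF \<open>finite R\<close>, of F] \<open>F \<subseteq> P\<close> \<open>P \<subseteq> R\<close> by blast
  note gen\<Lambda>' = generic_familyD[OF gen\<Lambda>]
  define E' where "E' = (\<lambda>(h, e). homothety_comp h e) ` (\<Lambda> \<times> E)"
  have proj: "\<exists>h \<in> \<Lambda>0. \<forall>t \<in> T. \<pi> (homothety e t) = homothety h t" if "e \<in> E" for e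
    using partite_systemD(1)[OF par that] .
  have PT: "q \<in> T" if eq: "e \<in> E" "q \<in> Q" "homothety e q \<in> P" for e q
  proof -
    obtain e' t where e': "e' \<in> E" "t \<in> T" "homothety e q = homothety e' t"
      using eq(3) by (auto simp: P_def)
    then have "e = e' \<or> q \<in> T \<and> t \<in> T" using gen'(3)[of e e' q t] eq Q(2) by blast
    then show ?thesis using e' homothety_inj[OF gen'(2)[OF eq(1)]] by metis
  qed
  have "generic_family T Q E'"
    unfolding generic_family_def
  proof (intro conjI ballI impI)
    show "finite E'" using gen'(1) gen\<Lambda>'(1) by (simp add: E'_def)
    show "fst h > 0" if "h \<in> E'" for h
      using that gen'(2) gen\<Lambda>'(2) by (auto simp: E'_def homothety_comp_def)
    fix j j' q q' assume "j \<in> E'" "j' \<in> E'" and q: "q \<in> Q" "q' \<in> Q"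
      and eq: "homothety j q = homothety j' q'"
    then obtain h e h' e' where h: "h \<in> \<Lambda>" "e \<in> E" "j = homothety_comp h e"
      and h': "h' \<in> \<Lambda>" "e' \<in> E" "j' = homothety_comp h' e'" by (auto simp: E'_def)
    have eq': "homothety h (homothety e q) = homothety h' (homothety e' q')"
      using eq h h' by simp
    have "homothety e q \<in> R" "homothety e' q' \<in> R" using h h' q by (auto simp: R_def)
    with gen\<Lambda>'(3)[OF h(1) h'(1) _ _ eq']
    consider "h = h'" | "homothety e q \<in> F" "homothety e' q' \<in> F" by blast
    then show "j = j' \<or> q \<in> T \<and> q' \<in> T"
    proof cases
      case 1
      then have "homothety e q = homothety e' q'"
        using eq' homothety_inj[OF gen\<Lambda>'(2)[OF h(1)]] by simp
      then have "e = e' \<or> q \<in> T \<and> q' \<in> T" using gen'(3) h h' q by blast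
      then show ?thesis using 1 h h' by blast
    next
      case 2
      then show ?thesis using PT \<open>F \<subseteq> P\<close> h h' q by blast
    qed
  qed
  moreover have "sparse (Suc m) (\<lambda>e. homothety e ` T) E'"
    unfolding E'_def
  proof (rule sparse_amalgam[OF m sp _ sp\<Lambda>, where P = P])
    fix e assume e: "e \<in> E"
    obtain h where h: "h \<in> \<Lambda>0" "\<forall>t \<in> T. \<pi> (homothety e t) = homothety h t" using proj[OF e] by blast
    have "t = t'" if "t \<in> T" "t' \<in> T" "homothety e t \<in> F" "homothety e t' \<in> F" for t t'
    proof -
      have "homothety h t = homothety h t'" using that h(2) by (auto simp: F_def)
      then show ?thesis using homothety_inj[OF \<Lambda>0[OF h(1)]] by blast
    qed
    then have "\<exists>a. homothety e ` T \<inter> F \<subseteq> {a}" by blast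
    then show "homothety e ` T \<subseteq> P \<and> (\<exists>a. homothety e ` T \<inter> F \<subseteq> {a})"
      using e by (auto simp: P_def)
  next
    show "h = h' \<or> q \<in> F \<and> q' \<in> F"
      if "h \<in> \<Lambda>" "h' \<in> \<Lambda>" "q \<in> P" "q' \<in> P" "homothety h q = homothety h' q'" for h h' q q'
      using gen\<Lambda>'(3) that \<open>P \<subseteq> R\<close> by blast
  qed (rule gen\<Lambda>'(2))
  moreover
  \<comment> \<open>Well defined: different copies of P overlap only in F, where \<pi> is constantly
    x.\<close>
  define \<pi>' where "\<pi>' y = (SOME z. \<exists>h \<in> \<Lambda>. \<exists>p \<in> P. y = homothety h p \<and> z = \<pi> p)" for y
  have \<pi>': "\<pi>' (homothety h p) = \<pi> p" if "h \<in> \<Lambda>" "p \<in> P" for h p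
  proof -
    have "\<exists>h' \<in> \<Lambda>. \<exists>p' \<in> P. homothety h p = homothety h' p' \<and> \<pi>' (homothety h p) = \<pi> p'"
      unfolding \<pi>'_def by (rule someI_ex) (use that in blast)
    then obtain h' p' where h': "h' \<in> \<Lambda>" "p' \<in> P" "homothety h p = homothety h' p'"
      "\<pi>' (homothety h p) = \<pi> p'" by blast
    have "h = h' \<or> p \<in> F \<and> p' \<in> F" using gen\<Lambda>'(3)[of h h' p p'] that h' \<open>P \<subseteq> R\<close> by blast
    then have "\<pi> p = \<pi> p'"
    proof
      assume "h = h'"
      then show ?thesis using h' homothety_inj[OF gen\<Lambda>'(2)[OF that(1)]] by simp
    qed (simp add: F_def)
    then show ?thesis using h' by simp
  qed
  have "partite_system r T \<Lambda>0 (insert x Y) E' \<pi>'"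
    unfolding partite_system_def
  proof (intro conjI ballI allI impI)
    fix j assume "j \<in> E'"
    then obtain h e where j: "h \<in> \<Lambda>" "e \<in> E" "j = homothety_comp h e" by (auto simp: E'_def)
    obtain h0 where h0: "h0 \<in> \<Lambda>0" "\<forall>t \<in> T. \<pi> (homothety e t) = homothety h0 t"
      using proj[OF j(2)] by blast
    have "\<pi>' (homothety j t) = homothety h0 t" if "t \<in> T" for t
      using \<pi>'[OF j(1), of "homothety e t"] h0(2) that j by (auto simp: P_def)
    then show "\<exists>h \<in> \<Lambda>0. \<forall>t \<in> T. \<pi>' (homothety j t) = homothety h t" using h0(1) by blast
  next
    fix c :: "real \<Rightarrow> nat" assume c: "\<forall>x. c x < r"
    obtain h \<kappa> where h: "h \<in> \<Lambda>" and \<kappa>: "\<And>t. t \<in> F \<Longrightarrow> c (homothety h t) = \<kappa>"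
      using ram c unfolding ramsey_family_def by metis
    have ch: "\<forall>x. (c \<circ> homothety h) x < r" using c by simp
    obtain \<xi> where \<xi>: "\<forall>x. \<xi> x < r" and
      e: "\<And>h0. h0 \<in> \<Lambda>0 \<Longrightarrow> \<exists>e \<in> E. \<forall>t \<in> T. \<pi> (homothety e t) = homothety h0 t \<and>
           (homothety h0 t \<in> Y \<longrightarrow> (c \<circ> homothety h) (homothety e t) = \<xi> (homothety h0 t))"
      using partite_systemD(2)[OF par ch] by metis
    \<comment> \<open>If F is empty, \<kappa> is unconstrained and could be \<ge> r;
      \<open>c 0\<close> is a colour below r.\<close>
    define \<xi>' where "\<xi>' = \<xi>(x := if F = {} then c 0 else \<kappa>)"
    have "\<forall>x. \<xi>' x < r"
    proof -
      have "\<kappa> < r" if "F \<noteq> {}" using that \<kappa> c by (metis ex_in_conv)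
      then show ?thesis using \<xi> c by (auto simp: \<xi>'_def)
    qed
    moreover have "\<exists>j \<in> E'. \<forall>t \<in> T. \<pi>' (homothety j t) = homothety h0 t \<and>
        (homothety h0 t \<in> insert x Y \<longrightarrow> c (homothety j t) = \<xi>' (homothety h0 t))"
      if h0: "h0 \<in> \<Lambda>0" for h0
    proof -
      obtain e where eE: "e \<in> E" and e1: "\<And>t. t \<in> T \<Longrightarrow> \<pi> (homothety e t) = homothety h0 t"
        and e2: "\<And>t. t \<in> T \<Longrightarrow> homothety h0 t \<in> Y \<Longrightarrow> c (homothety h (homothety e t)) = \<xi> (homothety h0 t)"
        using e[OF h0] by auto
      have P: "homothety e t \<in> P" if "t \<in> T" for t using that eE by (auto simp: P_def)
      show ?thesis
      proof (intro bexI[of _ "homothety_comp h e"] ballI conjI impI)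
        show "homothety_comp h e \<in> E'" using h eE by (auto simp: E'_def)
        fix t assume t: "t \<in> T"
        show "\<pi>' (homothety (homothety_comp h e) t) = homothety h0 t"
          using \<pi>'[OF h P[OF t]] e1[OF t] by simp
        assume mem: "homothety h0 t \<in> insert x Y"
        show "c (homothety (homothety_comp h e) t) = \<xi>' (homothety h0 t)"
        proof (cases "homothety h0 t = x")
          case True
          then have "homothety e t \<in> F" using P[OF t] e1[OF t] by (simp add: F_def)
          then show ?thesis using \<kappa> True by (auto simp: \<xi>'_def)
        next
          case False
          then show ?thesis using e2[OF t] mem by (simp add: \<xi>'_def)
        qed
      qed
    qed
    ultimately show "\<exists>\<xi>. (\<forall>x. \<xi> x < r) \<and> (\<forall>h0 \<in> \<Lambda>0. \<exists>j \<in> E'. \<forall>t \<in> T.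
        \<pi>' (homothety j t) = homothety h0 t \<and>
        (homothety h0 t \<in> insert x Y \<longrightarrow> c (homothety j t) = \<xi> (homothety h0 t)))" by blast
  qed
  ultimately show ?thesis by blast
qed

text \<open>Induction on m; order 1 is automatic. From a Hales-Jewett family \<Lambda> the fibres
  over all points X of its copies are processed one after the other. Then every colouring looks on
  suitable copies like a colouring \<xi> of the base, and a copy monochromatic for \<xi> lifts to
  one monochromatic for c.\<close>

theorem sparse_ramsey_family:
  assumes "finite Q" "T \<subseteq> Q"
  shows "\<exists>\<Lambda>. ramsey_family r T \<Lambda> \<and> generic_family T Q \<Lambda> \<and> sparse (Suc m) (\<lambda>h. homothety h ` T) \<Lambda>"
  using assms
proof (induction m arbitrary: T Q)
  case 0
  then show ?case using ramsey_family_exists sparse_one by (metis One_nat_def)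
next
  case (Suc m)
  obtain \<Lambda> where \<Lambda>: "ramsey_family r T \<Lambda>" "generic_family T Q \<Lambda>"
    using ramsey_family_exists[OF Suc.prems] by blast
  note gen = generic_familyD[OF \<Lambda>(2)]
  have T: "finite T" using Suc.prems finite_subset by blast
  have sys: "\<exists>E \<pi>. generic_family T Q E \<and> sparse (Suc (Suc m)) (\<lambda>e. homothety e ` T) E \<and>
      partite_system r T \<Lambda> Y E \<pi>" if "finite Y" for Y
    using that
  proof (induction Y)
    case empty
    show ?case by (rule partite_system_base[OF Suc.prems gen(1)])
  next
    case (insert x Y)
    then obtain E \<pi> where "generic_family T Q E" "sparse (Suc (Suc m)) (\<lambda>e. homothety e ` T) E"
      "partite_system r T \<Lambda> Y E \<pi>" by blast
    then show ?case
      by (rule partite_system_step[OF Suc.prems _ gen(2) Suc.IH, rotated -3]) simp_all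
  qed
  define X where "X = (\<Union>h \<in> \<Lambda>. homothety h ` T)"
  have "finite X" using gen(1) T by (simp add: X_def)
  then obtain E \<pi> where E: "generic_family T Q E" "sparse (Suc (Suc m)) (\<lambda>e. homothety e ` T) E"
    and par: "partite_system r T \<Lambda> X E \<pi>" using sys by blast
  have "ramsey_family r T E"
    unfolding ramsey_family_def
  proof (intro allI impI)
    fix c :: "real \<Rightarrow> nat" assume c: "\<forall>x. c x < r"
    obtain \<xi> where \<xi>: "\<forall>x. \<xi> x < r" and
      e: "\<And>h. h \<in> \<Lambda> \<Longrightarrow> \<exists>e \<in> E. \<forall>t \<in> T. \<pi> (homothety e t) = homothety h t \<and>
           (homothety h t \<in> X \<longrightarrow> c (homothety e t) = \<xi> (homothety h t))"
      using partite_systemD(2)[OF par c] by metis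
    obtain h \<kappa> where h: "h \<in> \<Lambda>" "\<forall>t \<in> T. \<xi> (homothety h t) = \<kappa>"
      using \<Lambda>(1) \<xi> unfolding ramsey_family_def by metis
    then obtain e where "e \<in> E" "\<forall>t \<in> T. c (homothety e t) = \<kappa>"
      using e[OF h(1)] by (force simp: X_def)
    then show "\<exists>h \<in> E. \<exists>\<kappa>. \<forall>t \<in> T. c (homothety h t) = \<kappa>" by blast
  qed
  then show ?case using E by blast
qed

section \<open>Tutte's construction\<close>

definition edges :: "'a set \<Rightarrow> ('a \<Rightarrow> 'a \<Rightarrow> bool) \<Rightarrow> 'a set set" where
  "edges V R = {{a, b} | a b. a \<in> V \<and> b \<in> V \<and> a \<noteq> b \<and> R a b}"

definition colourable :: "'a set \<Rightarrow> ('a \<Rightarrow> 'a \<Rightarrow> bool) \<Rightarrow> nat \<Rightarrow> bool" where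
  "colourable V R k \<longleftrightarrow> (\<exists>f. (\<forall>v \<in> V. f v < k) \<and>
     (\<forall>a \<in> V. \<forall>b \<in> V. a \<noteq> b \<and> R a b \<longrightarrow> f a \<noteq> f b))"

lemma edges_image:
  assumes "inj_on f V"
    and "\<And>a b. a \<in> V \<Longrightarrow> b \<in> V \<Longrightarrow> a \<noteq> b \<Longrightarrow> R' (f a) (f b) \<longleftrightarrow> R a b"
  shows "edges (f ` V) R' = (`) f ` edges V R"
proof
  show "edges (f ` V) R' \<subseteq> (`) f ` edges V R"
  proof
    fix j assume "j \<in> edges (f ` V) R'"
    then obtain a b where ab: "a \<in> V" "b \<in> V" "f a \<noteq> f b" "R' (f a) (f b)" "j = {f a, f b}"
      unfolding edges_def by blast
    then have "{a, b} \<in> edges V R" using assms(2)[of a b] unfolding edges_def by blast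
    moreover have "j = f ` {a, b}" using ab by simp
    ultimately show "j \<in> (`) f ` edges V R" by (rule rev_image_eqI)
  qed
  show "(`) f ` edges V R \<subseteq> edges (f ` V) R'"
  proof
    fix j assume "j \<in> (`) f ` edges V R"
    then obtain a b where ab: "a \<in> V" "b \<in> V" "a \<noteq> b" "R a b" "j = f ` {a, b}"
      unfolding edges_def by blast
    then have "f a \<noteq> f b" "R' (f a) (f b)" "j = {f a, f b}"
      using assms(2)[of a b] inj_onD[OF assms(1)] by auto
    then show "j \<in> edges (f ` V) R'" using ab(1,2) unfolding edges_def by blast
  qed
qed

lemma sparse_image:
  assumes inj: "inj_on f V" and E: "E \<subseteq> Pow V" and sp: "sparse m id E"
  shows "sparse m id ((`) f ` E)"
  unfolding sparse_def
proof (intro allI impI)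
  fix J assume JE: "J \<subseteq> (`) f ` E" and J: "J \<noteq> {} \<and> finite J \<and> card J \<le> m"
  define J0 where "J0 = {e \<in> E. f ` e \<in> J}"
  have injE: "inj_on ((`) f) J0"
    using inj_on_image_Pow[OF inj] by (rule inj_on_subset) (use E in \<open>auto simp: J0_def\<close>)
  have im: "(`) f ` J0 = J" using JE by (auto simp: J0_def)
  have J0: "J0 \<subseteq> E" "J0 \<noteq> {}" "finite J0" "card J0 \<le> m"
    using J im card_image[OF injE] finite_image_iff[OF injE] by (auto simp: J0_def)
  obtain e z where e: "e \<in> J0" and z: "id e \<inter> (\<Union>i \<in> J0 - {e}. id i) \<subseteq> {z}"
    using sparseD[OF sp J0] .
  have "f ` e \<inter> i \<subseteq> {f z}" if i: "i \<in> J - {f ` e}" for i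
  proof -
    obtain d where d: "d \<in> J0" "i = f ` d" using i im by blast
    then have "d \<in> J0 - {e}" using i by blast
    then have "e \<inter> d \<subseteq> {z}" using z by auto
    moreover have "f ` e \<inter> f ` d = f ` (e \<inter> d)"
      using inj_on_image_Int[OF inj, of e d] e d E J0(1) by blast
    ultimately show ?thesis using d by blast
  qed
  then have "id (f ` e) \<inter> (\<Union>i \<in> J - {f ` e}. id i) \<subseteq> {f z}" unfolding id_apply by blast
  moreover have "f ` e \<in> J" using e im by blast
  ultimately show "\<exists>j \<in> J. \<exists>z. id j \<inter> (\<Union>i \<in> J - {j}. id i) \<subseteq> {z}" by blast
qed

lemma edges_subset_Pow: "edges V R \<subseteq> Pow V"
  unfolding edges_def by blast

lemma colourable_image:
  assumes "\<And>a b. a \<in> V \<Longrightarrow> b \<in> V \<Longrightarrow> a \<noteq> b \<Longrightarrow> R' (f a) (f b) \<longleftrightarrow> R a b" and inj: "inj_on f V"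
    and "colourable (f ` V) R' k"
  shows "colourable V R k"
proof -
  obtain c where c: "\<And>v. v \<in> V \<Longrightarrow> c (f v) < k"
    "\<And>a b. a \<in> V \<Longrightarrow> b \<in> V \<Longrightarrow> f a \<noteq> f b \<Longrightarrow> R' (f a) (f b) \<Longrightarrow> c (f a) \<noteq> c (f b)"
    using assms(3) unfolding colourable_def by auto
  have "(c \<circ> f) a \<noteq> (c \<circ> f) b" if ab: "a \<in> V" "b \<in> V" "a \<noteq> b" "R a b" for a b
  proof -
    have "f a \<noteq> f b" using ab inj_onD[OF inj] by blast
    then show ?thesis using c(2)[of a b] assms(1)[of a b] ab by simp
  qed
  moreover have "(c \<circ> f) v < k" if "v \<in> V" for v using c(1)[OF that] by simp
  ultimately show ?thesis unfolding colourable_def by blast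
qed

definition sparse_graph :: "nat \<Rightarrow> nat \<Rightarrow> 'a set \<Rightarrow> ('a \<Rightarrow> 'a \<Rightarrow> bool) \<Rightarrow> bool" where
  "sparse_graph m k V R \<longleftrightarrow> sparse m id (edges V R) \<and> \<not> colourable V R k"

text \<open>Carries the graph from the abstract Tutte graph to pairs of centre and radius, and from
  those to spheres.\<close>

lemma sparse_graph_image:
  assumes inj: "inj_on f V"
    and R: "\<And>a b. a \<in> V \<Longrightarrow> b \<in> V \<Longrightarrow> a \<noteq> b \<Longrightarrow> R' (f a) (f b) \<longleftrightarrow> R a b"
    and "sparse_graph m k V R"
  shows "sparse_graph m k (f ` V) R'"
proof -
  have "edges (f ` V) R' = (`) f ` edges V R" using edges_image[of f V R' R] inj R by simp
  moreover have "\<not> colourable (f ` V) R' k"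
    using colourable_image[of V R' f R k] inj R assms(3) unfolding sparse_graph_def by metis
  ultimately show ?thesis
    using assms(3) sparse_image[OF inj edges_subset_Pow] by (simp add: sparse_graph_def)
qed

text \<open>\<open>Inl x\<close> is a point shared by the copies, later a line;
  \<open>Inr (h, v)\<close> is the vertex v in copy h of the graph, with a pendant edge to its point
  \<open>e h v\<close>.\<close>

fun tutte_rel :: "('h \<Rightarrow> 'v \<Rightarrow> 'x) \<Rightarrow> ('v \<Rightarrow> 'v \<Rightarrow> bool) \<Rightarrow> 'x + 'h \<times> 'v \<Rightarrow> 'x + 'h \<times> 'v \<Rightarrow> bool" where
  "tutte_rel e R (Inl x) (Inl y) = False"
| "tutte_rel e R (Inl x) (Inr (h, v)) = (x = e h v)"
| "tutte_rel e R (Inr (h, v)) (Inl x) = (x = e h v)"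
| "tutte_rel e R (Inr (h, v)) (Inr (h', v')) = (h = h' \<and> R v v')"

definition tutte_vertices :: "('h \<Rightarrow> 'v \<Rightarrow> 'x) \<Rightarrow> 'v set \<Rightarrow> 'h set \<Rightarrow> ('x + 'h \<times> 'v) set" where
  "tutte_vertices e V \<Lambda> = Inl ` (\<Union>h \<in> \<Lambda>. e h ` V) \<union> Inr ` (\<Lambda> \<times> V)"

lemma tutte_not_colourable:
  assumes V: "\<not> colourable V R k"
    and ramsey: "\<And>c. \<forall>x. c x < Suc k \<Longrightarrow> \<exists>h \<in> \<Lambda>. \<exists>\<kappa>::nat. \<forall>v \<in> V. c (e h v) = \<kappa>"
  shows "\<not> colourable (tutte_vertices e V \<Lambda>) (tutte_rel e R) (Suc k)"
proof
  let ?W = "tutte_vertices e V \<Lambda>"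
  assume "colourable ?W (tutte_rel e R) (Suc k)"
  then obtain f where "\<forall>w \<in> ?W. f w < Suc k"
    and "\<forall>a \<in> ?W. \<forall>b \<in> ?W. a \<noteq> b \<and> tutte_rel e R a b \<longrightarrow> f a \<noteq> f b"
    unfolding colourable_def by (elim exE conjE)
  note f = this(1)[rule_format] and pr = this(2)[rule_format, OF _ _ conjI]
  define c where "c x = (if Inl x \<in> ?W then f (Inl x) else 0)" for x
  have "\<forall>x. c x < Suc k" using f by (simp add: c_def)
  then obtain h \<kappa> where h: "h \<in> \<Lambda>" and \<kappa>: "\<And>v. v \<in> V \<Longrightarrow> c (e h v) = \<kappa>" using ramsey by metis
  have W: "Inl (e h v) \<in> ?W" "Inr (h, v) \<in> ?W" if "v \<in> V" for v
    using that h by (auto simp: tutte_vertices_def)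
  define g where "g v = f (Inr (h, v))" for v
  have fk: "f (Inl (e h v)) = \<kappa>" if "v \<in> V" for v
    using \<kappa>[OF that] W(1)[OF that] by (simp add: c_def)
  have g: "g v < Suc k" "g v \<noteq> \<kappa>" "\<kappa> < Suc k" if "v \<in> V" for v
    using f[OF W(2)[OF that]] pr[OF W[OF that]] fk[OF that] f[OF W(1)[OF that]]
    by (auto simp: g_def)
  have "colourable V R k"
    unfolding colourable_def
  \<comment> \<open>The colour \<kappa> is missing on the copy, so the colours above it move down by
    one to close the gap.\<close>
  proof (intro exI[of _ "\<lambda>v. if g v < \<kappa> then g v else g v - 1"] conjI ballI impI)
    show "(if g v < \<kappa> then g v else g v - 1) < k" if "v \<in> V" for v
      using g[OF that] by auto
    fix a b assume ab: "a \<in> V" "b \<in> V" "a \<noteq> b \<and> R a b"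
    then have "g a \<noteq> g b" using pr[OF W(2)[OF ab(1)] W(2)[OF ab(2)]] by (simp add: g_def)
    then show "(if g a < \<kappa> then g a else g a - 1) \<noteq> (if g b < \<kappa> then g b else g b - 1)"
      using g[OF ab(1)] g[OF ab(2)] by auto
  qed
  then show False using V by contradiction
qed

lemma tutte_edge_cases:
  assumes "j \<in> edges (tutte_vertices e V \<Lambda>) (tutte_rel e R)"
  obtains h v where "h \<in> \<Lambda>" "v \<in> V" "j = {Inl (e h v), Inr (h, v)}"
  | h d where "h \<in> \<Lambda>" "d \<in> edges V R" "j = (\<lambda>v. Inr (h, v)) ` d"
proof -
  from assms obtain a b where ab: "a \<in> tutte_vertices e V \<Lambda>" "b \<in> tutte_vertices e V \<Lambda>" "a \<noteq> b"
    "tutte_rel e R a b" "j = {a, b}" unfolding edges_def by blast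
  have mem: "h \<in> \<Lambda> \<and> v \<in> V" if "Inr (h, v) \<in> tutte_vertices e V \<Lambda>" for h v
    using that unfolding tutte_vertices_def by blast
  show thesis
  proof (cases a)
    case a: (Inl x)
    then obtain h v where b: "b = Inr (h, v)" using ab(4) by (cases b) auto
    then have "x = e h v" using ab(4) a by simp
    then show ?thesis using that(1)[of h v] ab(2,5) mem[of h v] a b by simp
  next
    case (Inr p)
    obtain h v where a: "a = Inr (h, v)" using Inr by (cases p) auto
    show ?thesis
    proof (cases b)
      case b: (Inl x)
      then have "x = e h v" using ab(4) a by simp
      then show ?thesis using that(1)[of h v] ab(1,5) mem[of h v] a b by (simp add: insert_commute)
    next
      case (Inr q)
      obtain v' where b: "b = Inr (h, v')" and R: "R v v'" using Inr ab(4) a by (cases q) auto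
      then have "{v, v'} \<in> edges V R"
        using ab(1-3) a mem[of h v] mem[of h v'] unfolding edges_def by blast
      then show ?thesis using that(2)[of h "{v, v'}"] ab(1,5) mem[of h v] a b by simp
    qed
  qed
qed

text \<open>A leaf among the copies \<open>h\<close> occurring in \<open>J\<close> meets the other copies in at most one vertex
  \<open>z\<close>. In that copy, either some pendant edge avoids \<open>z\<close> and is a leaf, or there is at most one
  pendant edge, and its endpoint serves as the marked point for a leaf of \<open>V\<close>.\<close>

lemma tutte_sparse:
  assumes V: "sparse m id (edges V R)" and \<Lambda>: "sparse m (\<lambda>h. e h ` V) \<Lambda>"
    and inj: "\<And>h. h \<in> \<Lambda> \<Longrightarrow> inj_on (e h) V"
  shows "sparse m id (edges (tutte_vertices e V \<Lambda>) (tutte_rel e R))"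
  unfolding sparse_def
proof (intro allI impI)
  define pend where "pend h v = {Inl (e h v), Inr (h, v)}" for h v
  define lift where "lift h d = (\<lambda>v. Inr (h, v) :: 'c + 'b \<times> 'a) ` d" for h d
  fix J assume JE: "J \<subseteq> edges (tutte_vertices e V \<Lambda>) (tutte_rel e R)"
    and "J \<noteq> {} \<and> finite J \<and> card J \<le> m"
  then have J: "J \<noteq> {}" "finite J" "card J \<le> m" by auto
  have "\<exists>h. h \<in> \<Lambda> \<and> ((\<exists>v \<in> V. j = pend h v) \<or> (\<exists>d \<in> edges V R. j = lift h d))"
    if "j \<in> J" for j
  proof -
    have "j \<in> edges (tutte_vertices e V \<Lambda>) (tutte_rel e R)" using that JE by blast
    then show ?thesis by (rule tutte_edge_cases) (unfold pend_def lift_def, blast+)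
  qed
  then obtain hh where hh: "\<And>j. j \<in> J \<Longrightarrow> hh j \<in> \<Lambda> \<and>
      ((\<exists>v \<in> V. j = pend (hh j) v) \<or> (\<exists>d \<in> edges V R. j = lift (hh j) d))" by metis
  have pend_r: "h' = h" if "Inr (h, v) \<in> pend h' v'" for h h' v v'
    using that by (auto simp: pend_def)
  have pend_l: "x = e h v" if "Inl x \<in> pend h v" for h v x
    using that by (auto simp: pend_def)
  have lift_r: "h' = h" if "Inr (h, v) \<in> lift h' d" for h h' v d
    using that by (auto simp: lift_def)
  have lift_l: "Inl x \<notin> lift h d" for h d x
    by (auto simp: lift_def)
  have inr: "hh j = h" if j: "j \<in> J" "Inr (h, v) \<in> j" for j h v
    using hh[OF j(1)] j(2) pend_r lift_r by metis
  have inl: "\<exists>v \<in> V. x = e (hh j) v \<and> j = pend (hh j) v" if j: "j \<in> J" "Inl x \<in> j" for j x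
    using hh[OF j(1)] j(2) pend_l lift_l by metis
  have "hh ` J \<subseteq> \<Lambda>" using hh by blast
  moreover have "hh ` J \<noteq> {}" "finite (hh ` J)" using J by simp_all
  moreover have "card (hh ` J) \<le> m" using card_image_le[OF J(2), of hh] J(3) by linarith
  ultimately obtain h z where h: "h \<in> hh ` J"
    and z: "e h ` V \<inter> (\<Union>i \<in> hh ` J - {h}. e i ` V) \<subseteq> {z}"
    using sparseD[OF \<Lambda>, of "hh ` J"] by metis
  have inj_h: "v = v'" if "v \<in> V" "v' \<in> V" "e h v = e h v'" for v v'
    using inj_onD[OF inj] that h \<open>hh ` J \<subseteq> \<Lambda>\<close> by blast
  obtain j0 where j0: "j0 \<in> J" "hh j0 = h" using h by blast
  define leaf where "leaf j a \<longleftrightarrow> (\<forall>i \<in> J - {j}. j \<inter> i \<subseteq> {a})" for j a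
  have "\<exists>j \<in> J. \<exists>a. leaf j a"
  proof (cases "\<exists>v \<in> V. pend h v \<in> J \<and> e h v \<noteq> z")
    case True
    then obtain v where v: "v \<in> V" "pend h v \<in> J" "e h v \<noteq> z" by blast
    have "Inl (e h v) \<notin> i" if i: "i \<in> J - {pend h v}" for i
    proof
      assume mem: "Inl (e h v) \<in> i"
      then obtain v' where v': "v' \<in> V" "e h v = e (hh i) v'" "i = pend (hh i) v'"
        using inl[of i] i by blast
      show False
      proof (cases "hh i = h")
        case True
        then have "v = v'" using inj_h[OF v(1) v'(1)] v'(2) by simp
        then show False using i v'(3) True by simp
      next
        case False
        then have "e h v \<in> e h ` V \<inter> (\<Union>i \<in> hh ` J - {h}. e i ` V)" using v' v(1) i by blast
        then show False using z v(3) by blast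
      qed
    qed
    then have "leaf (pend h v) (Inr (h, v))" unfolding leaf_def pend_def by blast
    then show ?thesis using v(2) by blast
  next
    case False
    then have pz: "e h v = z" if "v \<in> V" "pend h v \<in> J" for v using that by blast
    \<comment> \<open>Injectivity of \<open>e h\<close> leaves at most one pendant edge here; if
      there is none, y is arbitrary.\<close>
    then obtain y where y: "\<And>v. v \<in> V \<Longrightarrow> pend h v \<in> J \<Longrightarrow> v = y" using inj_h by metis
    define D where "D = {d \<in> edges V R. lift h d \<in> J}"
    have form: "(\<exists>v \<in> V. i = pend h v) \<or> (\<exists>d \<in> D. i = lift h d)" if "i \<in> J" "hh i = h" for i
      using hh[OF that(1), unfolded that(2)] that(1) unfolding D_def by blast
    show ?thesis
    proof (cases "D = {}")
      case True
      \<comment> \<open>No graph edge of this copy occurs, so \<open>j0\<close> is its only edge in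
        J and its end in the copy lies on no other edge.\<close>
      obtain v where v: "v \<in> V" "j0 = pend h v" using form[OF j0] True by blast
      have "Inr (h, v) \<notin> i" if i: "i \<in> J - {j0}" for i
      proof
        assume "Inr (h, v) \<in> i"
        then have "hh i = h" using inr[of i h v] i by blast
        then obtain v' where "v' \<in> V" "i = pend h v'" using form[of i] i True by blast
        then show False using y[of v] y[of v'] v j0(1) i by auto
      qed
      then have "leaf j0 (Inl (e h v))" unfolding leaf_def v(2) pend_def by blast
      then show ?thesis using j0(1) by blast
    next
      case False
      have injl: "inj_on (lift h) D" unfolding lift_def by (intro inj_onI) (simp add: inj_image_eq_iff inj_def)
      have sub: "lift h ` D \<subseteq> J" by (auto simp: D_def)
      have "finite D" using finite_subset[OF sub J(2)] finite_image_iff[OF injl] by blast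
      moreover have "card D \<le> m" using card_mono[OF J(2) sub] card_image[OF injl] J(3) by linarith
      moreover have "D \<subseteq> edges V R" by (auto simp: D_def)
      ultimately obtain d a where d: "d \<in> D" and a: "id d \<inter> insert y (\<Union>i \<in> D - {d}. id i) \<subseteq> {a}"
        using sparse_pointed_leaf[OF V _ False, of y] by metis
      have "lift h d \<inter> i \<subseteq> {Inr (h, a)}" if i: "i \<in> J - {lift h d}" for i
      proof
        fix x assume x: "x \<in> lift h d \<inter> i"
        then obtain v where v: "v \<in> d" "x = Inr (h, v)" unfolding lift_def by blast
        have "hh i = h" using inr[of i h v] i x v by blast
        then consider v' where "v' \<in> V" "i = pend h v'" | d' where "d' \<in> D" "i = lift h d'"
          using form[of i] i by blast
        then have "v = a"
        proof cases
          case 1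
          then have "v = v'" using x v by (auto simp: pend_def)
          then have "v = y" using y[of v'] 1 i by auto
          then show ?thesis using a v(1) by auto
        next
          case 2
          then have "d' \<in> D - {d}" "v \<in> d'" using i x v by (auto simp: lift_def)
          then show ?thesis using a v(1) unfolding id_apply by blast
        qed
        then show "x \<in> {Inr (h, a)}" using v by simp
      qed
      then have "leaf (lift h d) (Inr (h, a))" unfolding leaf_def by blast
      then show ?thesis using d unfolding D_def by blast
    qed
  qed
  then show "\<exists>j \<in> J. \<exists>z. id j \<inter> (\<Union>i \<in> J - {j}. id i) \<subseteq> {z}"
    unfolding leaf_def id_apply by blast
qed

text \<open>Each edge of a cycle meets its predecessor and its successor in two different vertices,
  so none of the edges is a leaf.\<close>

lemma sparse_no_short_cycle:
  assumes sp: "sparse m id (snd G)" and cyc: "is_cycle G vs"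
  shows "length vs > m"
proof (rule ccontr)
  define n where "n = length vs"
  define E where "E i = {vs ! i, vs ! (Suc i mod n)}" for i
  have n: "n \<ge> 3" and dist: "distinct vs" and E: "\<And>i. i < n \<Longrightarrow> E i \<in> snd G"
    using cyc by (auto simp: is_cycle_def n_def E_def)
  assume "\<not> length vs > m"
  then have "card (E ` {..<n}) \<le> m" using card_image_le[of "{..<n}" E] by (simp add: n_def)
  moreover have "E ` {..<n} \<subseteq> snd G" "E ` {..<n} \<noteq> {}" "finite (E ` {..<n})"
    using E n by (auto simp: lessThan_empty_iff)
  ultimately obtain j z where "j \<in> E ` {..<n}"
    and z: "id j \<inter> (\<Union>i \<in> E ` {..<n} - {j}. id i) \<subseteq> {z}"
    using sparseD[OF sp, of "E ` {..<n}"] by metis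
  then obtain i where i: "i < n" "j = E i" by blast
  have neq: "vs ! a \<noteq> vs ! b" if "a < n" "b < n" "a \<noteq> b" for a b
    using dist that by (simp add: nth_eq_iff_index_eq n_def)
  define s where "s = Suc i mod n"
  define s2 where "s2 = Suc s mod n"
  define p where "p = (if i = 0 then n - 1 else i - 1)"
  have sn: "s = (if Suc i = n then 0 else Suc i)" "s2 = (if Suc s = n then 0 else Suc s)"
    "s < n" "s2 < n" "p < n" "Suc p mod n = i"
    using i n by (auto simp: s_def s2_def p_def mod_Suc)
  have ne: "i \<noteq> s" "s2 \<noteq> i" "p \<noteq> i" "p \<noteq> s" "s2 \<noteq> s"
    using sn n i by (auto simp: p_def split: if_splits)
  have Es: "E i = {vs ! i, vs ! s}" "E s = {vs ! s, vs ! s2}" "E p = {vs ! p, vs ! i}"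
    using sn by (auto simp: E_def s_def s2_def)
  have "E s \<noteq> E i" "E p \<noteq> E i"
    using Es neq sn ne i by (auto simp: doubleton_eq_iff)
  then have "E s \<in> E ` {..<n} - {j}" "E p \<in> E ` {..<n} - {j}" using sn i by auto
  then have "E i \<inter> E s \<subseteq> {z}" "E i \<inter> E p \<subseteq> {z}" using z unfolding id_apply i(2) by blast+
  moreover have "vs ! s \<in> E i \<inter> E s" "vs ! i \<in> E i \<inter> E p" unfolding Es by simp_all
  ultimately have "{vs ! s, vs ! i} \<subseteq> {z}" by blast
  then show False using neq[OF i(1) sn(3) ne(1)] by simp
qed

section \<open>Circles, lines and inversion\<close>

text \<open>For positive radii this is the law of cosines at a common point of two circles that meet
  at an angle with cosine q. Squaring accounts for both angles between the tangents and avoids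
  absolute values.\<close>

definition adj :: "real \<Rightarrow> plane \<times> real \<Rightarrow> plane \<times> real \<Rightarrow> bool" where
  "adj q A B \<longleftrightarrow> ((norm (fst A - fst B))\<^sup>2 - (snd A)\<^sup>2 - (snd B)\<^sup>2)\<^sup>2 = (2 * snd A * snd B * q)\<^sup>2"

lemma adj_commute: "adj q A B \<longleftrightarrow> adj q B A"
  by (simp add: adj_def norm_minus_commute[of "fst A"] algebra_simps)

lemma norm_diff_sq: "(norm (a - b))\<^sup>2 = a \<bullet> a - 2 * (a \<bullet> b) + b \<bullet> b" for a b :: "'a :: real_inner"
  by (simp add: power2_norm_eq_inner inner_diff inner_commute)

definition power_of_point :: "plane \<Rightarrow> plane \<times> real \<Rightarrow> real" where
  "power_of_point p A = (fst A - p) \<bullet> (fst A - p) - (snd A)\<^sup>2"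

text \<open>The images of a circle and of the line \<open>u \<bullet> x = y\<close> under inversion in the unit circle around
  \<open>p\<close>, in coordinates centred at \<open>p\<close>.\<close>

definition invert_circle :: "plane \<Rightarrow> plane \<times> real \<Rightarrow> plane \<times> real" where
  "invert_circle p A = ((1 / power_of_point p A) *\<^sub>R (fst A - p), snd A / \<bar>power_of_point p A\<bar>)"

definition invert_line :: "plane \<Rightarrow> plane \<Rightarrow> real \<Rightarrow> plane \<times> real" where
  "invert_line p u y = ((1 / (2 * (y - u \<bullet> p))) *\<^sub>R u, 1 / \<bar>2 * (y - u \<bullet> p)\<bar>)"

lemma sq_eq_scale:
  fixes x y s :: real
  assumes "s \<noteq> 0"
  shows "(x / s)\<^sup>2 = (y / s)\<^sup>2 \<longleftrightarrow> x\<^sup>2 = y\<^sup>2"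
  using assms by (simp add: power_divide)

text \<open>Inversion divides both the difference of squares in \<open>adj\<close> and the product
  of the radii by P * P', up to sign, where P and P' are the powers of p. The absolute value of
  their ratio is unchanged.\<close>

lemma adj_invert_circles:
  assumes "power_of_point p A \<noteq> 0" "power_of_point p B \<noteq> 0"
  shows "adj q (invert_circle p A) (invert_circle p B) \<longleftrightarrow> adj q A B"
proof -
  define P P' a b where "P = power_of_point p A" and "P' = power_of_point p B"
    and "a = fst A - p" and "b = fst B - p"
  have P: "a \<bullet> a = P + (snd A)\<^sup>2" "b \<bullet> b = P' + (snd B)\<^sup>2"
    by (simp_all add: P_def P'_def a_def b_def power_of_point_def)
  have nz: "P \<noteq> 0" "P' \<noteq> 0" using assms by (simp_all add: P_def P'_def)
  have "(norm ((1 / P) *\<^sub>R a - (1 / P') *\<^sub>R b))\<^sup>2 =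
      (P + (snd A)\<^sup>2) / P\<^sup>2 - 2 * (a \<bullet> b) / (P * P') + (P' + (snd B)\<^sup>2) / P'\<^sup>2"
    unfolding norm_diff_sq using nz by (simp add: P power2_eq_square)
  then have 1: "(norm ((1 / P) *\<^sub>R a - (1 / P') *\<^sub>R b))\<^sup>2 - (snd A / \<bar>P\<bar>)\<^sup>2 - (snd B / \<bar>P'\<bar>)\<^sup>2 =
      (P + P' - 2 * (a \<bullet> b)) / (P * P')"
    using nz by (simp add: power_divide) (simp add: field_simps power2_eq_square)
  have "(norm (fst A - fst B))\<^sup>2 = (norm (a - b))\<^sup>2" by (simp add: a_def b_def)
  also have "\<dots> = P + P' - 2 * (a \<bullet> b) + (snd A)\<^sup>2 + (snd B)\<^sup>2" by (simp add: norm_diff_sq P)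
  finally have 2: "(norm (fst A - fst B))\<^sup>2 - (snd A)\<^sup>2 - (snd B)\<^sup>2 = P + P' - 2 * (a \<bullet> b)" by simp
  have 3: "(2 * (snd A / \<bar>P\<bar>) * (snd B / \<bar>P'\<bar>) * q)\<^sup>2 = ((2 * snd A * snd B * q) / (P * P'))\<^sup>2"
    by (simp add: power_mult_distrib power_divide)
  show ?thesis
    unfolding adj_def invert_circle_def fst_conv snd_conv P_def[symmetric] P'_def[symmetric]
      a_def[symmetric] b_def[symmetric] 1 2 3
    using nz by (intro sq_eq_scale) simp
qed

text \<open>Both sides of \<open>adj\<close> carry the factor 1 / (P * d), up to sign. What remains
  compares the signed distance from the centre to the line with q times the radius, hence the two
  signs.\<close>

lemma adj_invert_line_circle:
  assumes "norm u = 1" "y - u \<bullet> p \<noteq> 0" "power_of_point p A \<noteq> 0"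
  shows "adj q (invert_line p u y) (invert_circle p A) \<longleftrightarrow>
    y = u \<bullet> fst A + q * snd A \<or> y = u \<bullet> fst A - q * snd A"
proof -
  define P d a where "P = power_of_point p A" and "d = y - u \<bullet> p" and "a = fst A - p"
  have P: "a \<bullet> a = P + (snd A)\<^sup>2" by (simp add: P_def a_def power_of_point_def)
  have nz: "P \<noteq> 0" "d \<noteq> 0" using assms by (simp_all add: P_def d_def)
  have "u \<bullet> u = 1" using assms(1) by (simp add: norm_eq_1)
  then have "(norm ((1 / (2 * d)) *\<^sub>R u - (1 / P) *\<^sub>R a))\<^sup>2 =
      1 / (4 * d\<^sup>2) - (u \<bullet> a) / (P * d) + (P + (snd A)\<^sup>2) / P\<^sup>2"
    unfolding norm_diff_sq using nz by (simp add: P power2_eq_square)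
  then have 1: "(norm ((1 / (2 * d)) *\<^sub>R u - (1 / P) *\<^sub>R a))\<^sup>2 - (1 / \<bar>2 * d\<bar>)\<^sup>2 - (snd A / \<bar>P\<bar>)\<^sup>2 =
      (d - u \<bullet> a) / (P * d)"
    using nz by (simp add: power_divide) (simp add: field_simps power2_eq_square)
  have 2: "(2 * (1 / \<bar>2 * d\<bar>) * (snd A / \<bar>P\<bar>) * q)\<^sup>2 = ((q * snd A) / (P * d))\<^sup>2"
    by (simp add: power_mult_distrib power_divide mult.commute)
  have "adj q (invert_line p u y) (invert_circle p A) \<longleftrightarrow> (d - u \<bullet> a)\<^sup>2 = (q * snd A)\<^sup>2"
    unfolding adj_def invert_circle_def invert_line_def fst_conv snd_conv P_def[symmetric]
      d_def[symmetric] a_def[symmetric] 1 2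
    using nz by (intro sq_eq_scale) simp
  moreover have "d - u \<bullet> a = y - u \<bullet> fst A" by (simp add: d_def a_def inner_diff_right)
  ultimately show ?thesis by (auto simp: power2_eq_iff)
qed

text \<open>The images of parallel lines are tangent at the inversion centre, or equal, so the
  difference of squares in \<open>adj\<close> is in absolute value twice the product of the
  radii.\<close>

lemma not_adj_invert_lines:
  assumes "norm u = 1" "y - u \<bullet> p \<noteq> 0" "y' - u \<bullet> p \<noteq> 0" "0 \<le> q" "q < 1"
  shows "\<not> adj q (invert_line p u y) (invert_line p u y')"
proof -
  define d d' where "d = y - u \<bullet> p" and "d' = y' - u \<bullet> p"
  have nz: "d \<noteq> 0" "d' \<noteq> 0" using assms by (simp_all add: d_def d'_def)
  have "u \<bullet> u = 1" using assms(1) by (simp add: norm_eq_1)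
  then have "(norm ((1 / (2 * d)) *\<^sub>R u - (1 / (2 * d')) *\<^sub>R u))\<^sup>2 =
      1 / (4 * d\<^sup>2) - 1 / (2 * (d * d')) + 1 / (4 * d'\<^sup>2)"
    unfolding norm_diff_sq using nz by (simp add: power2_eq_square)
  then have 1: "(norm ((1 / (2 * d)) *\<^sub>R u - (1 / (2 * d')) *\<^sub>R u))\<^sup>2 - (1 / \<bar>2 * d\<bar>)\<^sup>2 - (1 / \<bar>2 * d'\<bar>)\<^sup>2 =
      (- 1) / (2 * (d * d'))"
    using nz by (simp add: power_divide power_mult_distrib)
  have 2: "(2 * (1 / \<bar>2 * d\<bar>) * (1 / \<bar>2 * d'\<bar>) * q)\<^sup>2 = (q / (2 * (d * d')))\<^sup>2"
    by (simp add: power_mult_distrib power_divide)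
  have "adj q (invert_line p u y) (invert_line p u y') \<longleftrightarrow> (- 1)\<^sup>2 = q\<^sup>2"
    unfolding adj_def invert_line_def fst_conv snd_conv
      d_def[symmetric] d'_def[symmetric] 1 2
    using nz by (intro sq_eq_scale) simp
  moreover have "q\<^sup>2 < 1" using assms(4,5) by (simp add: abs_square_less_1)
  ultimately show ?thesis by simp
qed

lemma not_adj_far:
  assumes "snd A > 0" "snd B > 0" "0 \<le> q" "q < 1" "snd A + snd B < norm (fst A - fst B)"
  shows "\<not> adj q A B"
proof -
  define x where "x = (norm (fst A - fst B))\<^sup>2 - (snd A)\<^sup>2 - (snd B)\<^sup>2"
  have "(snd A + snd B)\<^sup>2 < (norm (fst A - fst B))\<^sup>2"
    using assms by (intro power_strict_mono) auto
  then have "x > 2 * snd A * snd B" by (simp add: x_def power2_sum)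
  moreover have "2 * snd A * snd B * q \<le> 2 * snd A * snd B"
    using assms by (intro mult_left_le) auto
  ultimately have "2 * snd A * snd B * q < x" by linarith
  then have "(2 * snd A * snd B * q)\<^sup>2 < x\<^sup>2"
    using assms by (intro power_strict_mono) auto
  then show ?thesis by (simp add: adj_def x_def)
qed

lemma adj_similar:
  assumes "l > 0" "fst A' - fst B' = l *\<^sub>R (fst A - fst B)" "snd A' = l * snd A" "snd B' = l * snd B"
  shows "adj q A' B' \<longleftrightarrow> adj q A B"
proof -
  define x where "x = (norm (fst A - fst B))\<^sup>2 - (snd A)\<^sup>2 - (snd B)\<^sup>2"
  have "(norm (fst A' - fst B'))\<^sup>2 - (snd A')\<^sup>2 - (snd B')\<^sup>2 = l\<^sup>2 * x"
    unfolding assms(2-4) norm_scaleR x_def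
    by (simp only: power_mult_distrib power2_abs right_diff_distrib)
  moreover have "2 * snd A' * snd B' * q = l\<^sup>2 * (2 * snd A * snd B * q)"
    using assms by (simp add: power2_eq_square)
  ultimately have "adj q A' B' \<longleftrightarrow> (l\<^sup>2)\<^sup>2 * x\<^sup>2 = (l\<^sup>2)\<^sup>2 * (2 * snd A * snd B * q)\<^sup>2"
    by (simp only: adj_def power_mult_distrib)
  also have "\<dots> \<longleftrightarrow> x\<^sup>2 = (2 * snd A * snd B * q)\<^sup>2" using assms(1) by simp
  finally show ?thesis by (simp add: adj_def x_def)
qed

section \<open>Plane geometry: directions, tangent lines and angles\<close>

lemma inner_plane: "(x::plane) \<bullet> y = x $ 1 * y $ 1 + x $ 2 * y $ 2"
  by (simp add: inner_vec_def sum_2)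

lemma vec_eq_plane: "(x::plane) = y \<longleftrightarrow> x $ 1 = y $ 1 \<and> x $ 2 = y $ 2"
  by (simp add: vec_eq_iff forall_2)

text \<open>The unit vectors are parametrised rationally by \<open>s\<close>, so each condition \<open>u \<bullet> a = b\<close> becomes a
  nonzero polynomial equation in \<open>s\<close>.\<close>

lemma generic_direction:
  fixes S :: "(plane \<times> real) set"
  assumes "finite S" "\<And>a b. (a, b) \<in> S \<Longrightarrow> a \<noteq> 0"
  obtains u w :: plane where "norm u = 1" "norm w = 1" "u \<bullet> w = 0"
    "\<And>x y. x \<bullet> y = (u \<bullet> x) * (u \<bullet> y) + (w \<bullet> x) * (w \<bullet> y)"
    "\<And>a b. (a, b) \<in> S \<Longrightarrow> u \<bullet> a \<noteq> b"
proof -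
  \<comment> \<open>The polynomial (1 + s^2) * (u \<bullet> a - b) in s for u = (1 - s^2, 2 * s) /
    (1 + s^2).\<close>
  define pl where "pl z = [:fst z $ 1 - snd z, 2 * fst z $ 2, - (fst z $ 1 + snd z):]" for z :: "plane \<times> real"
  have "pl z \<noteq> 0" if "z \<in> S" for z
    using assms(2)[of "fst z" "snd z"] that by (auto simp: pl_def vec_eq_plane)
  then have "finite (\<Union>z \<in> S. {s. poly (pl z) s = 0})"
    using assms(1) by (intro finite_UN_I poly_roots_finite)
  then obtain s :: real where s: "s \<notin> (\<Union>z \<in> S. {s. poly (pl z) s = 0})"
    using ex_new_if_finite infinite_UNIV_char_0 by blast
  define r where "r = 1 + s\<^sup>2"
  have r: "r > 0" by (simp add: r_def add_pos_nonneg)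
  define \<alpha> \<beta> where "\<alpha> = (1 - s\<^sup>2) / r" and "\<beta> = 2 * s / r"
  have "(1 - s\<^sup>2)\<^sup>2 + (2 * s)\<^sup>2 = r\<^sup>2" by (simp add: r_def power2_eq_square algebra_simps)
  then have unit: "\<alpha>\<^sup>2 + \<beta>\<^sup>2 = 1"
    using r by (simp add: \<alpha>_def \<beta>_def power_divide flip: add_divide_distrib)
  define u w :: plane where "u = vector [\<alpha>, \<beta>]" and "w = vector [- \<beta>, \<alpha>]"
  have uw: "u $ 1 = \<alpha>" "u $ 2 = \<beta>" "w $ 1 = - \<beta>" "w $ 2 = \<alpha>" by (simp_all add: u_def w_def)
  show thesis
  proof (rule that[of u w])
    show "norm u = 1" "norm w = 1" "u \<bullet> w = 0"
      using unit by (simp_all add: norm_eq_1 inner_plane uw power2_eq_square algebra_simps)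
    show "x \<bullet> y = (u \<bullet> x) * (u \<bullet> y) + (w \<bullet> x) * (w \<bullet> y)" for x y
    proof -
      have "(u \<bullet> x) * (u \<bullet> y) + (w \<bullet> x) * (w \<bullet> y) = (\<alpha>\<^sup>2 + \<beta>\<^sup>2) * (x \<bullet> y)"
        by (simp add: inner_plane uw power2_eq_square algebra_simps)
      then show ?thesis using unit by simp
    qed
    fix a b assume ab: "(a, b) \<in> S"
    have "poly (pl (a, b)) s \<noteq> 0" using s ab by blast
    moreover have "poly (pl (a, b)) s = r * (u \<bullet> a - b)"
      using r by (simp add: pl_def inner_plane uw \<alpha>_def \<beta>_def field_simps)
        (simp add: r_def power2_eq_square algebra_simps)
    ultimately show "u \<bullet> a \<noteq> b" by auto
  qed
qed

text \<open>In the plane a vector orthogonal to n is a multiple of the quarter turn of n, so the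
  angle between x and y has the same squared cosine as that between n and m. Clearing denominators
  admits zero vectors x and y.\<close>

lemma orthogonal_cos_sq:
  fixes x y n m :: plane
  assumes "x \<bullet> n = 0" "y \<bullet> m = 0" "n \<noteq> 0" "m \<noteq> 0"
  shows "(x \<bullet> y)\<^sup>2 * (norm n * norm m)\<^sup>2 = (n \<bullet> m)\<^sup>2 * (norm x * norm y)\<^sup>2"
proof -
  have par: "\<exists>s. x $ 1 = - s * n $ 2 \<and> x $ 2 = s * n $ 1" if "x \<bullet> n = 0" "n \<noteq> 0" for x n :: plane
  proof -
    have nz: "(n $ 1)\<^sup>2 + (n $ 2)\<^sup>2 \<noteq> 0" using that(2) by (auto simp: vec_eq_plane sum_power2_eq_zero_iff)
    define s where "s = (x $ 2 * n $ 1 - x $ 1 * n $ 2) / ((n $ 1)\<^sup>2 + (n $ 2)\<^sup>2)"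
    have o: "x $ 1 * n $ 1 + x $ 2 * n $ 2 = 0" using that(1) by (simp add: inner_plane)
    have "x $ 1 * ((n $ 1)\<^sup>2 + (n $ 2)\<^sup>2) = - (x $ 2 * n $ 1 - x $ 1 * n $ 2) * n $ 2"
      using o by algebra
    moreover have "x $ 2 * ((n $ 1)\<^sup>2 + (n $ 2)\<^sup>2) = (x $ 2 * n $ 1 - x $ 1 * n $ 2) * n $ 1"
      using o by algebra
    ultimately show ?thesis using nz by (intro exI[of _ s]) (simp add: s_def field_simps)
  qed
  obtain s where s: "x $ 1 = - s * n $ 2" "x $ 2 = s * n $ 1" using par assms by blast
  obtain t where t: "y $ 1 = - t * m $ 2" "y $ 2 = t * m $ 1" using par assms by blast
  show ?thesis
    unfolding power_mult_distrib power2_norm_eq_inner inner_plane s t by algebra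
qed

text \<open>All pairs of directions have cosine \<kappa> or - \<kappa>, so arccos \<kappa> is a
  lower bound. It is attained by the quarter turns of the normals, one of them reversed if n
  \<bullet> m < 0.\<close>

lemma line_angle_eq:
  fixes n m p :: plane
  assumes nz: "n \<noteq> 0" "m \<noteq> 0"
  shows "line_angle {x. (x - p) \<bullet> n = 0} {x. (x - p) \<bullet> m = 0} = arccos (\<bar>n \<bullet> m\<bar> / (norm n * norm m))"
proof -
  let ?L = "{x. (x - p) \<bullet> n = 0}" and ?M = "{x. (x - p) \<bullet> m = 0}"
  define \<kappa> where "\<kappa> = \<bar>n \<bullet> m\<bar> / (norm n * norm m)"
  define S where "S = {vector_angle (b - a) (d - c) | a b c d.
     a \<in> ?L \<and> b \<in> ?L \<and> a \<noteq> b \<and> c \<in> ?M \<and> d \<in> ?M \<and> c \<noteq> d}"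
  have nm: "norm n * norm m > 0" using nz by simp
  have \<kappa>: "0 \<le> \<kappa>" "\<kappa> \<le> 1"
    using nm Cauchy_Schwarz_ineq2[of n m] by (simp_all add: \<kappa>_def)
  have lower: "arccos \<kappa> \<le> \<phi>" if \<phi>S: "\<phi> \<in> S" for \<phi>
  proof -
    obtain a b c d where abcd: "a \<in> ?L" "b \<in> ?L" "a \<noteq> b" "c \<in> ?M" "d \<in> ?M" "c \<noteq> d"
      and \<phi>: "\<phi> = vector_angle (b - a) (d - c)" using \<phi>S unfolding S_def by blast
    define x y where "x = b - a" and "y = d - c"
    have xn: "x \<bullet> n = 0" "y \<bullet> m = 0"
      using abcd by (simp_all add: x_def y_def inner_diff_left)
    have xy: "norm x * norm y > 0" using abcd by (simp add: x_def y_def)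
    have "(x \<bullet> y / (norm x * norm y))\<^sup>2 = \<kappa>\<^sup>2"
      unfolding \<kappa>_def power_divide power2_abs
      using orthogonal_cos_sq[OF xn nz] xy nm by (subst frac_eq_eq) auto
    then have "\<bar>x \<bullet> y / (norm x * norm y)\<bar> = \<kappa>"
      using \<kappa>(1) by (metis abs_of_nonneg power2_eq_iff abs_minus)
    then have "x \<bullet> y / (norm x * norm y) \<le> \<kappa>" "- 1 \<le> x \<bullet> y / (norm x * norm y)"
      using \<kappa> by linarith+
    then show ?thesis
      using \<kappa> unfolding \<phi> vector_angle_def x_def[symmetric] y_def[symmetric]
      by (intro arccos_le_arccos) auto
  qed
  define J where "J v = (vector [- v $ 2, v $ 1] :: plane)" for v :: plane
  have J: "J v $ 1 = - v $ 2" "J v $ 2 = v $ 1" for v by (simp_all add: J_def)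
  have Jn: "J v \<bullet> v = 0" "norm (J v) = norm v" "J v \<bullet> J v' = v \<bullet> v'" for v v'
    by (simp_all add: inner_plane J norm_eq_sqrt_inner)
  have J0: "J v \<noteq> 0" if "v \<noteq> 0" for v using Jn(2)[of v] that by (metis norm_eq_zero)
  define \<sigma> :: real where "\<sigma> = (if n \<bullet> m \<ge> 0 then 1 else - 1)"
  have "vector_angle (p + J n - p) (p + \<sigma> *\<^sub>R J m - p) = arccos \<kappa>"
    by (simp add: vector_angle_def Jn \<kappa>_def \<sigma>_def)
  moreover have "p \<in> ?L" "p + J n \<in> ?L" "p \<noteq> p + J n" "p \<in> ?M" "p + \<sigma> *\<^sub>R J m \<in> ?M" "p \<noteq> p + \<sigma> *\<^sub>R J m"
    using J0 nz by (simp_all add: Jn \<sigma>_def)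
  ultimately have "arccos \<kappa> \<in> S" unfolding S_def by (smt (verit) mem_Collect_eq)
  then have "Inf S = arccos \<kappa>" using lower by (rule cInf_eq_minimum)
  then show ?thesis by (simp add: line_angle_def S_def \<kappa>_def)
qed

text \<open>On the first circle the distance to c' takes the values |d - r| and d + r at the ends of
  the diameter in direction c', d being the distance of the centres. The circle is connected, so r'
  is attained in between.\<close>

lemma spheres_meet:
  fixes c c' :: plane
  assumes "r > 0" "\<bar>norm (c - c') - r\<bar> \<le> r'" "r' \<le> norm (c - c') + r" "c \<noteq> c'"
  shows "sphere c r \<inter> sphere c' r' \<noteq> {}"
proof -
  define v where "v = (r / norm (c - c')) *\<^sub>R (c - c')"
  have n: "norm (c - c') > 0" using assms(4) by simp
  have v: "norm v = r" using n assms(1) by (simp add: v_def)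
  have pm: "c + v \<in> sphere c r" "c - v \<in> sphere c r" using v by (simp_all add: dist_norm)
  have "c + v - c' = (1 + r / norm (c - c')) *\<^sub>R (c - c')" by (simp add: v_def algebra_simps)
  then have "dist c' (c + v) = \<bar>1 + r / norm (c - c')\<bar> * norm (c - c')"
    by (metis dist_commute dist_norm norm_scaleR)
  also have "\<dots> = norm (c - c') + r" using n assms(1) by (simp add: field_simps)
  finally have up: "dist c' (c + v) = norm (c - c') + r" .
  have "c - v - c' = (1 - r / norm (c - c')) *\<^sub>R (c - c')" by (simp add: v_def algebra_simps)
  then have "dist c' (c - v) = \<bar>1 - r / norm (c - c')\<bar> * norm (c - c')"
    by (metis dist_commute dist_norm norm_scaleR)
  also have "\<dots> = \<bar>(1 - r / norm (c - c')) * norm (c - c')\<bar>" by (simp add: abs_mult)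
  also have "(1 - r / norm (c - c')) * norm (c - c') = norm (c - c') - r"
    using n by (simp add: field_simps)
  finally have low: "dist c' (c - v) = \<bar>norm (c - c') - r\<bar>" .
  have "connected (sphere c r)" by (rule connected_sphere) simp
  then have "connected (dist c' ` sphere c r)" by (intro connected_continuous_image continuous_intros)
  then have "r' \<in> dist c' ` sphere c r"
  proof (rule connectedD_interval)
    show "dist c' (c - v) \<in> dist c' ` sphere c r" "dist c' (c + v) \<in> dist c' ` sphere c r"
      using pm by blast+
    show "dist c' (c - v) \<le> r'" "r' \<le> dist c' (c + v)" using assms up low by simp_all
  qed
  then show ?thesis by auto
qed

text \<open>At a common point the radii are normals of the tangents, and the law of cosines makes
  their inner product depend on the centres and radii only. Conversely, \<open>adj\<close> gives |d|
  \<le> 2 * r * r', which yields the inequalities that \<open>spheres_meet\<close> requires.\<close>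

lemma intersect_at_angle_iff_adj:
  assumes \<theta>: "0 < \<theta>" "\<theta> \<le> pi / 2" and r: "r > 0" "r' > 0" and ne: "c \<noteq> c'"
  shows "intersect_at_angle \<theta> (sphere c r) (sphere c' r') \<longleftrightarrow> adj (cos \<theta>) (c, r) (c', r')"
proof -
  define d where "d = (norm (c - c'))\<^sup>2 - r\<^sup>2 - r'\<^sup>2"
  have rr: "2 * r * r' > 0" using r by simp
  have cos: "0 \<le> cos \<theta>" "cos \<theta> < 1" using \<theta> cos_monotone_0_pi[of 0 \<theta>] pi_gt_zero by (auto intro: cos_ge_zero)
  have adj: "adj (cos \<theta>) (c, r) (c', r') \<longleftrightarrow> \<bar>d\<bar> = 2 * r * r' * cos \<theta>"
  proof -
    have "\<bar>2 * r * r' * cos \<theta>\<bar> = 2 * r * r' * cos \<theta>" using r cos by simp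
    moreover have "adj (cos \<theta>) (c, r) (c', r') \<longleftrightarrow> \<bar>d\<bar> = \<bar>2 * r * r' * cos \<theta>\<bar>"
      unfolding adj_def fst_conv snd_conv d_def[symmetric] power2_eq_iff abs_eq_iff ..
    ultimately show ?thesis by simp
  qed
  have angle: "line_angle (tangent_line (sphere c r) p) (tangent_line (sphere c' r') p) = arccos (\<bar>d\<bar> / (2 * r * r'))
      \<and> \<bar>d\<bar> \<le> 2 * r * r'"
    if p: "p \<in> sphere c r" "p \<in> sphere c' r'" for p
  proof -
    have n: "norm (p - c) = r" "norm (p - c') = r'" using p by (simp_all add: dist_norm norm_minus_commute)
    have "(norm (c - c'))\<^sup>2 = (norm ((p - c') - (p - c)))\<^sup>2" by simp
    also have "\<dots> = r'\<^sup>2 - 2 * ((p - c) \<bullet> (p - c')) + r\<^sup>2"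
      unfolding norm_diff_sq[of "p - c'"] by (simp add: n inner_commute flip: power2_norm_eq_inner)
    finally have "\<bar>d\<bar> = 2 * \<bar>(p - c) \<bullet> (p - c')\<bar>" by (simp add: d_def)
    moreover have "p - c \<noteq> 0" "p - c' \<noteq> 0" using n r by auto
    ultimately show ?thesis
      using line_angle_eq[of "p - c" "p - c'" p] Cauchy_Schwarz_ineq2[of "p - c" "p - c'"] n
      by (simp add: tangent_line_def centre_sphere r)
  qed
  show ?thesis
  proof
    assume "intersect_at_angle \<theta> (sphere c r) (sphere c' r')"
    then obtain p where "p \<in> sphere c r" "p \<in> sphere c' r'"
      "line_angle (tangent_line (sphere c r) p) (tangent_line (sphere c' r') p) = \<theta>"
      unfolding intersect_at_angle_def by blast
    with angle[of p] have "arccos (\<bar>d\<bar> / (2 * r * r')) = \<theta>" "\<bar>d\<bar> \<le> 2 * r * r'" by auto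
    then have "cos \<theta> = \<bar>d\<bar> / (2 * r * r')" using rr by (auto intro!: cos_arccos_abs)
    then have "\<bar>d\<bar> = 2 * r * r' * cos \<theta>" using r by simp
    then show "adj (cos \<theta>) (c, r) (c', r')" using adj by blast
  next
    assume "adj (cos \<theta>) (c, r) (c', r')"
    then have d: "\<bar>d\<bar> = 2 * r * r' * cos \<theta>" using adj by simp
    have "2 * r * r' * cos \<theta> \<le> 2 * r * r'" using rr cos by (intro mult_left_le) auto
    then have "(norm (c - c'))\<^sup>2 \<le> (r + r')\<^sup>2" "(r - r')\<^sup>2 \<le> (norm (c - c'))\<^sup>2"
      using d by (auto simp: d_def power2_sum power2_diff)
    then have "norm (c - c') \<le> r + r'" "\<bar>r - r'\<bar> \<le> norm (c - c')"
      using r by (auto simp: power2_le_iff_abs_le)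
    then have "sphere c r \<inter> sphere c' r' \<noteq> {}" using r ne by (intro spheres_meet) auto
    moreover have "arccos (\<bar>d\<bar> / (2 * r * r')) = \<theta>" using d r \<theta> by (simp add: arccos_cos)
    ultimately show "intersect_at_angle \<theta> (sphere c r) (sphere c' r')"
      unfolding intersect_at_angle_def using angle by auto
  qed
qed

text \<open>The forbidden p lie on finitely many circles and lines, a null set. The last two
  conditions keep the images from being concentric: in coordinates centred at p, images of lines
  have centres on the line spanned by u, which centres of images of circles avoid, and two different
  centres of circles are never collinear with p.\<close>

lemma generic_inversion_centre:
  fixes \<K> :: "(plane \<times> real) set"
  assumes fin: "finite \<K>" "finite X" and pos: "\<And>A. A \<in> \<K> \<Longrightarrow> snd A > 0"
    and uw: "norm u = 1" "norm w = 1" "u \<bullet> w = 0"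
      "\<And>x y. x \<bullet> y = (u \<bullet> x) * (u \<bullet> y) + (w \<bullet> x) * (w \<bullet> y)"
  obtains p where "\<And>A. A \<in> \<K> \<Longrightarrow> power_of_point p A \<noteq> 0" "\<And>x. x \<in> X \<Longrightarrow> x - u \<bullet> p \<noteq> 0"
    "\<And>A. A \<in> \<K> \<Longrightarrow> w \<bullet> (fst A - p) \<noteq> 0"
    "\<And>A B. A \<in> \<K> \<Longrightarrow> B \<in> \<K> \<Longrightarrow> fst A \<noteq> fst B \<Longrightarrow>
       (u \<bullet> (fst A - p)) * (w \<bullet> (fst B - p)) \<noteq> (w \<bullet> (fst A - p)) * (u \<bullet> (fst B - p))"
proof -
  \<comment> \<open>For a \<noteq> b, a normal vector of the line through a and b.\<close>
  define nrm where "nrm a b = (w \<bullet> (a - b)) *\<^sub>R u - (u \<bullet> (a - b)) *\<^sub>R w" for a b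
  define S1 where "S1 = (\<lambda>A. sphere (fst A) (snd A)) ` \<K>"
  define S2 where "S2 = (\<lambda>x. {p. u \<bullet> p = x}) ` X"
  define S3 where "S3 = (\<lambda>A. {p. w \<bullet> p = w \<bullet> fst A}) ` \<K>"
  define S4 where "S4 = (\<lambda>(A, B). {p. nrm (fst A) (fst B) \<bullet> p = nrm (fst A) (fst B) \<bullet> fst A}) `
    {(A, B) \<in> \<K> \<times> \<K>. fst A \<noteq> fst B}"
  have unit: "u \<bullet> u = 1" "w \<bullet> w = 1" using uw(1,2) by (simp_all add: norm_eq_1)
  have "u \<noteq> 0" "w \<noteq> 0" using uw(1,2) by auto
  have nrm: "nrm a b \<noteq> 0" if "a \<noteq> b" for a b
  proof
    assume "nrm a b = 0"
    then have "u \<bullet> nrm a b = 0" "w \<bullet> nrm a b = 0" by simp_all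
    then have "w \<bullet> (a - b) = 0" "u \<bullet> (a - b) = 0"
      using unit uw(3) by (simp_all add: nrm_def inner_diff_right inner_commute)
    then have "(a - b) \<bullet> (a - b) = 0" unfolding uw(4)[of "a - b"] by simp
    then show False using that by simp
  qed
  have "finite (S1 \<union> S2 \<union> S3 \<union> S4)"
  proof -
    have "finite {(A, B) \<in> \<K> \<times> \<K>. fst A \<noteq> fst B}"
      by (rule finite_subset[of _ "\<K> \<times> \<K>"]) (use fin in auto)
    then show ?thesis using fin by (simp add: S1_def S2_def S3_def S4_def)
  qed
  moreover have "negligible N" if N: "N \<in> S1 \<union> S2 \<union> S3 \<union> S4" for N
  proof -
    consider "N \<in> S1" | "N \<in> S2" | "N \<in> S3" | "N \<in> S4" using N by blast
    then show ?thesis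
    proof cases
      case 1
      then show ?thesis unfolding S1_def using negligible_sphere by blast
    next
      case 2
      then show ?thesis unfolding S2_def using negligible_hyperplane \<open>u \<noteq> 0\<close> by blast
    next
      case 3
      then show ?thesis unfolding S3_def using negligible_hyperplane \<open>w \<noteq> 0\<close> by blast
    next
      case 4
      then obtain A B where "fst A \<noteq> fst B" "N = {p. nrm (fst A) (fst B) \<bullet> p = nrm (fst A) (fst B) \<bullet> fst A}"
        unfolding S4_def by auto
      then show ?thesis using negligible_hyperplane nrm by blast
    qed
  qed
  ultimately have "negligible (\<Union>(S1 \<union> S2 \<union> S3 \<union> S4))" by (rule negligible_Union)
  then have "\<Union>(S1 \<union> S2 \<union> S3 \<union> S4) \<noteq> UNIV" using non_negligible_UNIV by metis
  then obtain p where p: "p \<notin> \<Union>(S1 \<union> S2 \<union> S3 \<union> S4)" by blast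
  then have p': "p \<notin> \<Union>S1" "p \<notin> \<Union>S2" "p \<notin> \<Union>S3" "p \<notin> \<Union>S4" by simp_all
  show thesis
  proof (rule that[of p])
    show "power_of_point p A \<noteq> 0" if A: "A \<in> \<K>" for A
    proof
      assume "power_of_point p A = 0"
      then have "(norm (fst A - p))\<^sup>2 = (snd A)\<^sup>2" by (simp add: power_of_point_def power2_norm_eq_inner)
      then have "norm (fst A - p) = snd A" using pos[OF A] by (simp add: power2_eq_iff_nonneg)
      then have "p \<in> sphere (fst A) (snd A)" by (simp add: dist_norm)
      then show False using p'(1) A unfolding S1_def by blast
    qed
    show "x - u \<bullet> p \<noteq> 0" if "x \<in> X" for x
      using p'(2) that unfolding S2_def by auto
    show "w \<bullet> (fst A - p) \<noteq> 0" if "A \<in> \<K>" for A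
      using p'(3) that unfolding S3_def by (auto simp: inner_diff_right)
    fix A B assume AB: "A \<in> \<K>" "B \<in> \<K>" "fst A \<noteq> fst B"
    have "{p. nrm (fst A) (fst B) \<bullet> p = nrm (fst A) (fst B) \<bullet> fst A} \<in> S4"
      unfolding S4_def by (rule image_eqI[of _ _ "(A, B)"]) (use AB in simp_all)
    then have "nrm (fst A) (fst B) \<bullet> p \<noteq> nrm (fst A) (fst B) \<bullet> fst A"
      using p'(4) by blast
    then show "(u \<bullet> (fst A - p)) * (w \<bullet> (fst B - p)) \<noteq> (w \<bullet> (fst A - p)) * (u \<bullet> (fst B - p))"
      by (simp add: nrm_def inner_diff_left inner_diff_right algebra_simps)
  qed
qed

section \<open>Configurations without concentric circles and the inductive step\<close>

definition circle_config :: "(plane \<times> real) set \<Rightarrow> bool" where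
  "circle_config \<C> \<longleftrightarrow> finite \<C> \<and> (\<forall>A \<in> \<C>. snd A > 0) \<and> inj_on fst \<C>"

text \<open>In the application f is the position of a centre in the direction w and g is a radius,
  so the shifted copies become disjoint. Multiples of K serve, as K exceeds the positions and radii
  of any two circles together.\<close>

lemma separating_shifts:
  fixes \<Lambda> :: "'h set" and f g :: "'h \<Rightarrow> 'c \<Rightarrow> real"
  assumes "finite \<Lambda>" "finite \<C>"
  obtains s where "\<And>h h' C D. \<lbrakk>h \<in> \<Lambda>; h' \<in> \<Lambda>; h \<noteq> h'; C \<in> \<C>; D \<in> \<C>\<rbrakk> \<Longrightarrow>
    \<bar>(f h C + s h) - (f h' D + s h')\<bar> > g h C + g h' D"
proof -
  obtain idx :: "'h \<Rightarrow> nat" where idx: "inj_on idx \<Lambda>"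
    using finite_imp_inj_to_nat_seg[OF assms(1)] by blast
  define F where "F = (\<lambda>(h, C). \<bar>f h C\<bar> + \<bar>g h C\<bar>) ` (\<Lambda> \<times> \<C>)"
  have "finite F" using assms by (simp add: F_def)
  then obtain B where B: "\<And>x. x \<in> F \<Longrightarrow> \<bar>x\<bar> \<le> B"
    using finite_imp_bounded[of F] unfolding bounded_iff by auto
  have bound: "\<bar>f h C\<bar> + \<bar>g h C\<bar> \<le> \<bar>B\<bar>" if "h \<in> \<Lambda>" "C \<in> \<C>" for h C
  proof -
    have "\<bar>f h C\<bar> + \<bar>g h C\<bar> \<in> F" using that by (force simp: F_def)
    then show ?thesis using B by fastforce
  qed
  define K where "K = 2 * \<bar>B\<bar> + 1"
  show thesis
  proof (rule that[of "\<lambda>h. K * real (idx h)"])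
    fix h h' C D assume h: "h \<in> \<Lambda>" "h' \<in> \<Lambda>" "h \<noteq> h'" "C \<in> \<C>" "D \<in> \<C>"
    then have "idx h \<noteq> idx h'" using inj_onD[OF idx] by blast
    then have "\<bar>real (idx h) - real (idx h')\<bar> \<ge> 1" by linarith
    then have "K * \<bar>real (idx h) - real (idx h')\<bar> \<ge> K * 1"
      by (intro mult_left_mono) (simp_all add: K_def)
    then have "\<bar>K * real (idx h) - K * real (idx h')\<bar> \<ge> K"
      by (simp add: abs_mult K_def flip: right_diff_distrib)
    then show "\<bar>(f h C + K * real (idx h)) - (f h' D + K * real (idx h'))\<bar> > g h C + g h' D"
      using bound[OF h(1,4)] bound[OF h(2,5)] unfolding K_def by linarith
  qed
qed

text \<open>Parallel lines never meet at angle \<open>\<theta> > 0\<close>, and a homothety of the plane acts on the lines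
  orthogonal to \<open>u\<close> as a homothety of the real line. Hence lines placed at a sparse Ramsey family
  for the heights \<open>t C\<close>, together with one copy of \<open>\<C>\<close> per homothety, realise Tutte's
  construction; an inversion turns the lines into circles. The second line \<open>t' C\<close> meeting \<open>C\<close> at
  angle \<open>\<theta>\<close> is kept out by genericity of the family.\<close>

lemma circle_step:
  assumes q: "0 \<le> q" "q < 1" and conf: "circle_config \<C>" and gr: "sparse_graph (Suc m) k \<C> (adj q)"
  obtains \<C>' where "circle_config \<C>'" "sparse_graph (Suc m) (Suc k) \<C>' (adj q)"
proof -
  have fin: "finite \<C>" and pos: "\<And>A. A \<in> \<C> \<Longrightarrow> snd A > 0" and inj: "inj_on fst \<C>"
    using conf by (auto simp: circle_config_def)
  define Pr where "Pr = {(A, B) \<in> \<C> \<times> \<C>. A \<noteq> B}"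
  \<comment> \<open>To be avoided are the directions with t A = t B or t A = t' B for different
    circles A and B, with t and t' as defined below. The difference vectors are nonzero because no
    two circles are concentric.\<close>
  define S where "S = (\<lambda>(A, B). (fst A - fst B, q * snd B - q * snd A)) ` Pr \<union>
    (\<lambda>(A, B). (fst A - fst B, - q * snd B - q * snd A)) ` Pr"
  have "finite Pr" by (rule finite_subset[of _ "\<C> \<times> \<C>"]) (use fin in \<open>auto simp: Pr_def\<close>)
  then have "finite S" by (simp add: S_def)
  moreover have "a \<noteq> 0" if ab: "(a, b) \<in> S" for a b
  proof -
    obtain A B where "A \<in> \<C>" "B \<in> \<C>" "A \<noteq> B" "a = fst A - fst B"
      using ab by (auto simp: S_def Pr_def)
    then show ?thesis using inj_onD[OF inj, of A B] by auto
  qed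
  ultimately obtain u w :: plane where uw: "norm u = 1" "norm w = 1" "u \<bullet> w = 0"
      "\<And>x y. x \<bullet> y = (u \<bullet> x) * (u \<bullet> y) + (w \<bullet> x) * (w \<bullet> y)"
    and dir: "\<And>a b. (a, b) \<in> S \<Longrightarrow> u \<bullet> a \<noteq> b"
    using generic_direction[of S] by metis
  \<comment> \<open>The two heights at which a line orthogonal to u meets the circle at an angle
    with cosine q; lines are drawn at copies of the heights t only.\<close>
  define t t' where "t C = u \<bullet> fst C + q * snd C" and "t' C = u \<bullet> fst C - q * snd C" for C
  have tt: "t A \<noteq> t B \<and> t A \<noteq> t' B" if AB: "A \<in> \<C>" "B \<in> \<C>" "A \<noteq> B" for A B
  proof -
    have "(A, B) \<in> Pr" using AB by (simp add: Pr_def)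
    then have "(fst A - fst B, q * snd B - q * snd A) \<in> S" "(fst A - fst B, - q * snd B - q * snd A) \<in> S"
      unfolding S_def by force+
    from dir[OF this(1)] dir[OF this(2)] show ?thesis
      by (auto simp: t_def t'_def inner_diff_right)
  qed
  define T Q where "T = t ` \<C>" and "Q = t ` \<C> \<union> t' ` \<C>"
  have "finite Q" "T \<subseteq> Q" using fin by (auto simp: T_def Q_def)
  then obtain \<Lambda> where ram: "ramsey_family (Suc k) T \<Lambda>" and gen: "generic_family T Q \<Lambda>"
    and sp: "sparse (Suc m) (\<lambda>h. homothety h ` T) \<Lambda>"
    using sparse_ramsey_family by blast
  note gen' = generic_familyD[OF gen]
  define e where "e h C = homothety h (t C)" for h C
  have inj_t: "inj_on t \<C>" using tt by (meson inj_onI)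
  have inj_e: "inj_on (e h) \<C>" if "h \<in> \<Lambda>" for h
    using inj_t homothety_inj[OF gen'(2)[OF that]] by (auto simp: e_def inj_on_def)
  have eT: "homothety h ` T = e h ` \<C>" for h by (auto simp: e_def T_def)
  define W where "W = tutte_vertices e \<C> \<Lambda>"
  have tutte: "sparse_graph (Suc m) (Suc k) W (tutte_rel e (adj q))"
    unfolding sparse_graph_def W_def
  proof
    show "sparse (Suc m) id (edges (tutte_vertices e \<C> \<Lambda>) (tutte_rel e (adj q)))"
      using gr sp inj_e by (intro tutte_sparse) (simp_all add: sparse_graph_def eT)
    show "\<not> colourable (tutte_vertices e \<C> \<Lambda>) (tutte_rel e (adj q)) (Suc k)"
    proof (rule tutte_not_colourable)
      show "\<not> colourable \<C> (adj q) k" using gr by (simp add: sparse_graph_def)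
      show "\<exists>h \<in> \<Lambda>. \<exists>\<kappa>. \<forall>v \<in> \<C>. c (e h v) = \<kappa>" if "\<forall>x. c x < Suc k" for c
        using ram that unfolding ramsey_family_def by (simp add: T_def e_def)
    qed
  qed
  obtain s where s: "\<And>h h' C D. \<lbrakk>h \<in> \<Lambda>; h' \<in> \<Lambda>; h \<noteq> h'; C \<in> \<C>; D \<in> \<C>\<rbrakk> \<Longrightarrow>
      \<bar>(fst h * (w \<bullet> fst C) + s h) - (fst h' * (w \<bullet> fst D) + s h')\<bar> > fst h * snd C + fst h' * snd D"
    using separating_shifts[OF gen'(1) fin, where f = "\<lambda>h C. fst h * (w \<bullet> fst C)"
        and g = "\<lambda>h C. fst h * snd C"] by metis
  \<comment> \<open>The shift by \<open>s h\<close> along w leaves the heights along u as they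
    are.\<close>
  define cp where "cp h C = (fst h *\<^sub>R fst C + snd h *\<^sub>R u + s h *\<^sub>R w, fst h * snd C)" for h and C :: "plane \<times> real"
  have unit: "u \<bullet> u = 1" "w \<bullet> w = 1" "w \<bullet> u = 0"
    using uw(1-3) by (simp_all add: norm_eq_1 inner_commute)
  have cp_u: "u \<bullet> fst (cp h C) = fst h * (u \<bullet> fst C) + snd h"
    and cp_w: "w \<bullet> fst (cp h C) = fst h * (w \<bullet> fst C) + s h" for h C
    using unit uw(3) by (simp_all add: cp_def inner_add_right)
  have cp_t: "u \<bullet> fst (cp h C) + q * snd (cp h C) = e h C"
    and cp_t': "u \<bullet> fst (cp h C) - q * snd (cp h C) = homothety h (t' C)" for h C
    unfolding cp_u by (simp_all add: cp_def e_def t_def t'_def homothety_def algebra_simps)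
  have cp_pos: "snd (cp h C) > 0" if "h \<in> \<Lambda>" "C \<in> \<C>" for h C
    using pos[OF that(2)] gen'(2)[OF that(1)] by (simp add: cp_def)
  have far: "snd (cp h C) + snd (cp h' D) < norm (fst (cp h C) - fst (cp h' D))"
    if "h \<in> \<Lambda>" "h' \<in> \<Lambda>" "h \<noteq> h'" "C \<in> \<C>" "D \<in> \<C>" for h h' C D
  proof -
    have "snd (cp h C) + snd (cp h' D) < \<bar>w \<bullet> (fst (cp h C) - fst (cp h' D))\<bar>"
      using s[OF that] unfolding inner_diff_right cp_w by (simp add: cp_def)
    also have "\<dots> \<le> norm (fst (cp h C) - fst (cp h' D))"
      using Cauchy_Schwarz_ineq2[of w "fst (cp h C) - fst (cp h' D)"] uw(2) by simp
    finally show ?thesis .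
  qed
  have cp_centre: "fst (cp h C) \<noteq> fst (cp h' D)"
    if "h \<in> \<Lambda>" "h' \<in> \<Lambda>" "C \<in> \<C>" "D \<in> \<C>" "(h, C) \<noteq> (h', D)" for h h' C D
  proof (cases "h = h'")
    case True
    then have "fst C \<noteq> fst D" using that inj_onD[OF inj] by blast
    then show ?thesis using True gen'(2)[OF that(1)] by (simp add: cp_def)
  next
    case False
    then show ?thesis
      using far[OF that(1,2) False that(3,4)] cp_pos[OF that(1,3)] cp_pos[OF that(2,4)] by auto
  qed
  define \<K> where "\<K> = (\<lambda>(h, C). cp h C) ` (\<Lambda> \<times> \<C>)"
  define X where "X = (\<Union>h \<in> \<Lambda>. e h ` \<C>)"
  have "finite \<K>" "finite X" using fin gen'(1) by (simp_all add: \<K>_def X_def)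
  moreover have "snd A > 0" if "A \<in> \<K>" for A using that cp_pos by (auto simp: \<K>_def)
  ultimately obtain p where p: "\<And>A. A \<in> \<K> \<Longrightarrow> power_of_point p A \<noteq> 0"
    "\<And>x. x \<in> X \<Longrightarrow> x - u \<bullet> p \<noteq> 0" "\<And>A. A \<in> \<K> \<Longrightarrow> w \<bullet> (fst A - p) \<noteq> 0"
    "\<And>A B. A \<in> \<K> \<Longrightarrow> B \<in> \<K> \<Longrightarrow> fst A \<noteq> fst B \<Longrightarrow>
       (u \<bullet> (fst A - p)) * (w \<bullet> (fst B - p)) \<noteq> (w \<bullet> (fst A - p)) * (u \<bullet> (fst B - p))"
    using generic_inversion_centre[of \<K> X u w] uw by metis
  define \<Phi> where "\<Phi> = case_sum (invert_line p u) (\<lambda>(h, C). invert_circle p (cp h C))"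
  have \<Phi>: "\<Phi> (Inl x) = invert_line p u x" "\<Phi> (Inr (h, C)) = invert_circle p (cp h C)" for x h C
    by (simp_all add: \<Phi>_def)
  have W_cases: "(\<exists>x \<in> X. a = Inl x) \<or> (\<exists>h \<in> \<Lambda>. \<exists>C \<in> \<C>. a = Inr (h, C))" if "a \<in> W" for a
    using that unfolding W_def tutte_vertices_def X_def by blast
  have cpK: "cp h C \<in> \<K>" if "h \<in> \<Lambda>" "C \<in> \<C>" for h C using that by (force simp: \<K>_def)
  have "finite W" using fin gen'(1) by (simp add: W_def tutte_vertices_def)
  have pos': "snd (\<Phi> a) > 0" if a: "a \<in> W" for a
    using W_cases[OF a]
  proof (elim disjE bexE)
    fix x assume "x \<in> X" "a = Inl x"
    then show ?thesis using p(2)[of x] by (simp add: \<Phi> invert_line_def)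
  next
    fix h C assume "h \<in> \<Lambda>" "C \<in> \<C>" "a = Inr (h, C)"
    then show ?thesis using p(1)[OF cpK] cp_pos by (simp add: \<Phi> invert_circle_def)
  qed
  have line_circle: "fst (invert_line p u x) \<noteq> fst (invert_circle p A)" if "x \<in> X" "A \<in> \<K>" for x A
  proof
    assume "fst (invert_line p u x) = fst (invert_circle p A)"
    then have "w \<bullet> fst (invert_line p u x) = w \<bullet> fst (invert_circle p A)" by simp
    then show False using p(1,3)[OF that(2)] unit(3) by (simp add: invert_line_def invert_circle_def)
  qed
  have circle_circle: "fst (invert_circle p A) \<noteq> fst (invert_circle p B)"
    if AB: "A \<in> \<K>" "B \<in> \<K>" "fst A \<noteq> fst B" for A B
  proof
    define \<alpha> \<beta> where "\<alpha> = 1 / power_of_point p A" and "\<beta> = 1 / power_of_point p B"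
    have nz: "\<alpha> \<noteq> 0" "\<beta> \<noteq> 0" using p(1) AB by (simp_all add: \<alpha>_def \<beta>_def)
    assume "fst (invert_circle p A) = fst (invert_circle p B)"
    then have "\<alpha> *\<^sub>R (fst A - p) = \<beta> *\<^sub>R (fst B - p)" by (simp add: invert_circle_def \<alpha>_def \<beta>_def)
    then have "u \<bullet> (\<alpha> *\<^sub>R (fst A - p)) = u \<bullet> (\<beta> *\<^sub>R (fst B - p))"
      "w \<bullet> (\<alpha> *\<^sub>R (fst A - p)) = w \<bullet> (\<beta> *\<^sub>R (fst B - p))" by simp_all
    then have "\<alpha> * (u \<bullet> (fst A - p)) = \<beta> * (u \<bullet> (fst B - p))"
      "\<alpha> * (w \<bullet> (fst A - p)) = \<beta> * (w \<bullet> (fst B - p))" by simp_all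
    then have "\<alpha> * (u \<bullet> (fst A - p)) * (\<beta> * (w \<bullet> (fst B - p))) =
        \<alpha> * (w \<bullet> (fst A - p)) * (\<beta> * (u \<bullet> (fst B - p)))" by simp
    then have "(u \<bullet> (fst A - p)) * (w \<bullet> (fst B - p)) = (w \<bullet> (fst A - p)) * (u \<bullet> (fst B - p))"
      using nz by simp
    then show False using p(4)[OF AB] by contradiction
  qed
  have centre: "fst (\<Phi> a) \<noteq> fst (\<Phi> b)" if ab: "a \<in> W" "b \<in> W" "a \<noteq> b" for a b
    using W_cases[OF ab(1)] W_cases[OF ab(2)]
  proof (elim disjE bexE)
    fix x y assume xy: "x \<in> X" "y \<in> X" "a = Inl x" "b = Inl y"
    then have "x - u \<bullet> p \<noteq> y - u \<bullet> p" "u \<noteq> 0" using ab(3) uw(1) by auto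
    then show ?thesis using p(2) xy by (simp add: \<Phi> invert_line_def)
  next
    fix x h C assume "x \<in> X" "a = Inl x" "h \<in> \<Lambda>" "C \<in> \<C>" "b = Inr (h, C)"
    then show ?thesis using line_circle[OF _ cpK] by (simp add: \<Phi>)
  next
    fix x h C assume "x \<in> X" "b = Inl x" "h \<in> \<Lambda>" "C \<in> \<C>" "a = Inr (h, C)"
    then show ?thesis using line_circle[OF _ cpK] by (metis \<Phi>)
  next
    fix h C h' D assume "h \<in> \<Lambda>" "C \<in> \<C>" "a = Inr (h, C)" "h' \<in> \<Lambda>" "D \<in> \<C>" "b = Inr (h', D)"
    then show ?thesis using circle_circle[OF cpK cpK] cp_centre[of h h' C D] ab(3) by (simp add: \<Phi>)
  qed
  have lc: "adj q (invert_line p u x) (invert_circle p (cp h C)) \<longleftrightarrow> x = e h C"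
    if x: "x \<in> X" and h: "h \<in> \<Lambda>" "C \<in> \<C>" for x h C
  proof -
    \<comment> \<open>For a line at the second height of C, genericity puts \<open>t' C\<close> into
      T, hence \<open>t' C = t E\<close> for some E, and \<open>tt\<close> leaves only E = C, where
      both heights agree.\<close>
    have "x = e h C" if eq: "x = homothety h (t' C)"
    proof -
      obtain h' D where D: "h' \<in> \<Lambda>" "D \<in> \<C>" "x = homothety h' (t D)"
        using x by (auto simp: X_def e_def)
      have "t D \<in> Q" "t' C \<in> Q" using D h by (auto simp: Q_def)
      then have "h = h' \<or> t' C \<in> T" using gen'(3)[OF h(1) D(1)] eq D(3) by metis
      moreover have "t D \<in> T" using D(2) by (simp add: T_def)
      ultimately have "t' C \<in> T" using eq D(3) homothety_inj[OF gen'(2)[OF h(1)]] by metis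
      then obtain E where "E \<in> \<C>" "t' C = t E" by (auto simp: T_def)
      then show ?thesis using tt[of E C] h(2) eq by (metis e_def)
    qed
    then show ?thesis
      unfolding adj_invert_line_circle[OF uw(1) p(2)[OF x] p(1)[OF cpK[OF h]]] cp_t cp_t' by blast
  qed
  have cc: "adj q (cp h C) (cp h' D) \<longleftrightarrow> h = h' \<and> adj q C D"
    if hC: "h \<in> \<Lambda>" "C \<in> \<C>" "h' \<in> \<Lambda>" "D \<in> \<C>" for h h' C D
  proof (cases "h = h'")
    case True
    have "adj q (cp h C) (cp h D) \<longleftrightarrow> adj q C D"
      by (rule adj_similar[OF gen'(2)[OF hC(1)]]) (simp_all add: cp_def algebra_simps)
    then show ?thesis using True by simp
  next
    case False
    then show ?thesis
      using not_adj_far[OF cp_pos[OF hC(1,2)] cp_pos[OF hC(3,4)] q far[OF hC(1,3) False hC(2,4)]] by simp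
  qed
  have rel: "adj q (\<Phi> a) (\<Phi> b) \<longleftrightarrow> tutte_rel e (adj q) a b" if ab: "a \<in> W" "b \<in> W" for a b
    using W_cases[OF ab(1)] W_cases[OF ab(2)]
  proof (elim disjE bexE)
    fix x y assume "x \<in> X" "y \<in> X" "a = Inl x" "b = Inl y"
    then show ?thesis using not_adj_invert_lines[OF uw(1) p(2) p(2) q] by (simp add: \<Phi>)
  next
    fix x h C assume "x \<in> X" "a = Inl x" "h \<in> \<Lambda>" "C \<in> \<C>" "b = Inr (h, C)"
    then show ?thesis using lc by (simp add: \<Phi>)
  next
    fix x h C assume "x \<in> X" "b = Inl x" "h \<in> \<Lambda>" "C \<in> \<C>" "a = Inr (h, C)"
    then show ?thesis using lc by (simp add: \<Phi> adj_commute[of q "invert_circle p (cp h C)"])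
  next
    fix h C h' D assume hC: "h \<in> \<Lambda>" "C \<in> \<C>" "a = Inr (h, C)" "h' \<in> \<Lambda>" "D \<in> \<C>" "b = Inr (h', D)"
    then show ?thesis
      using adj_invert_circles[OF p(1) p(1), OF cpK cpK, of h C h' D] cc by (simp add: \<Phi>)
  qed
  have "inj_on \<Phi> W" using centre by (metis inj_onI)
  then have "sparse_graph (Suc m) (Suc k) (\<Phi> ` W) (adj q)"
    using rel tutte by (intro sparse_graph_image) auto
  moreover have "circle_config (\<Phi> ` W)"
    unfolding circle_config_def
  proof (intro conjI)
    show "finite (\<Phi> ` W)" using \<open>finite W\<close> by simp
    show "\<forall>A \<in> \<Phi> ` W. snd A > 0" using pos' by blast
    show "inj_on fst (\<Phi> ` W)"
    proof (rule inj_onI)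
      fix A B assume "A \<in> \<Phi> ` W" "B \<in> \<Phi> ` W" and eq: "fst A = fst B"
      then obtain a b where "a \<in> W" "b \<in> W" "A = \<Phi> a" "B = \<Phi> b" by blast
      then show "A = B" using centre[of a b] eq by blast
    qed
  qed
  ultimately show thesis using that by blast
qed

lemma circle_config_exists:
  assumes "0 \<le> q" "q < 1"
  shows "\<exists>\<C>. circle_config \<C> \<and> sparse_graph (Suc m) k \<C> (adj q)"
proof (induction k)
  case 0
  \<comment> \<open>One circle is enough for k = 0, since no vertex can be coloured with zero
    colours.\<close>
  let ?C = "{(0 :: plane, 1 :: real)}"
  have "edges ?C (adj q) = {}" by (auto simp: edges_def)
  then have "sparse_graph (Suc m) 0 ?C (adj q)"
    by (simp add: sparse_graph_def colourable_def sparse_def)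
  moreover have "circle_config ?C" by (simp add: circle_config_def)
  ultimately show ?case by blast
next
  case (Suc k)
  then show ?case using circle_step[OF assms] by metis
qed

theorem theorem8:
  fixes \<theta> :: real and g k :: nat
  assumes "0 < \<theta>" and "\<theta> \<le> pi / 2" and "g \<ge> 3" and "k \<ge> 1"
  shows "\<exists>\<C> :: plane set set.
    (\<forall>C \<in> \<C>. is_circle C) \<and>
    (\<forall>C \<in> \<C>. \<forall>D \<in> \<C>. C \<noteq> D \<longrightarrow> \<not> concentric C D) \<and>
    girth (theta_graph \<theta> \<C>) \<ge> enat g \<and>
    chromatic_number (theta_graph \<theta> \<C>) \<ge> enat k"
proof -
  have q: "0 \<le> cos \<theta>" "cos \<theta> < 1"
    using assms(1,2) cos_monotone_0_pi[of 0 \<theta>] pi_gt_zero by (auto intro: cos_ge_zero)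
  \<comment> \<open>Order \<open>Suc g\<close> excludes all cycles of length at most
    \<open>Suc g\<close>, in particular those shorter than g.\<close>
  obtain \<C> where conf: "circle_config \<C>" and gr: "sparse_graph (Suc g) k \<C> (adj (cos \<theta>))"
    using circle_config_exists[OF q] by blast
  have pos: "\<And>A. A \<in> \<C> \<Longrightarrow> snd A > 0" and inj: "inj_on fst \<C>"
    using conf by (auto simp: circle_config_def)
  define sp where "sp A = sphere (fst A) (snd A)" for A :: "plane \<times> real"
  have ctr: "centre (sp A) = fst A" if "A \<in> \<C>" for A
    using pos[OF that] by (simp add: sp_def centre_sphere)
  have inj_sp: "inj_on sp \<C>" using inj ctr by (metis inj_on_def)
  have "intersect_at_angle \<theta> (sp A) (sp B) \<longleftrightarrow> adj (cos \<theta>) A B"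
    if "A \<in> \<C>" "B \<in> \<C>" "A \<noteq> B" for A B
  proof -
    have "fst A \<noteq> fst B" using that inj_onD[OF inj] by blast
    then show ?thesis
      using intersect_at_angle_iff_adj[OF assms(1,2) pos[OF that(1)] pos[OF that(2)]] by (simp add: sp_def)
  qed
  then have graph: "sparse_graph (Suc g) k (sp ` \<C>) (intersect_at_angle \<theta>)"
    using gr by (intro sparse_graph_image[OF inj_sp])
  let ?G = "theta_graph \<theta> (sp ` \<C>)"
  have G: "fst ?G = sp ` \<C>" "snd ?G = edges (sp ` \<C>) (intersect_at_angle \<theta>)"
    by (simp_all add: theta_graph_def edges_def)
  have "girth ?G \<ge> enat g"
    unfolding girth_def
  proof (rule Inf_greatest)
    fix x assume "x \<in> {enat (length vs) | vs. is_cycle ?G vs}"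
    then obtain vs where vs: "x = enat (length vs)" "is_cycle ?G vs" by blast
    have "sparse (Suc g) id (snd ?G)" using graph by (simp add: G sparse_graph_def)
    from sparse_no_short_cycle[OF this vs(2)] show "enat g \<le> x" using vs(1) by simp
  qed
  moreover have "chromatic_number ?G \<ge> enat k"
    unfolding chromatic_number_def
  proof (rule Inf_greatest)
    fix x assume "x \<in> {enat n | n. \<exists>f. is_proper_colouring ?G n f}"
    then obtain n f where x: "x = enat n" and f: "is_proper_colouring ?G n f" by blast
    have "\<not> n < k"
    proof
      assume "n < k"
      have "{a, b} \<in> snd ?G" if "a \<in> sp ` \<C>" "b \<in> sp ` \<C>" "a \<noteq> b" "intersect_at_angle \<theta> a b" for a b
        using that unfolding G edges_def by blast
      then have "f a \<noteq> f b" if "a \<in> sp ` \<C>" "b \<in> sp ` \<C>" "a \<noteq> b" "intersect_at_angle \<theta> a b" for a b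
        using f that unfolding is_proper_colouring_def G(1) by metis
      moreover have "f a < k" if "a \<in> sp ` \<C>" for a
        using f that \<open>n < k\<close> unfolding is_proper_colouring_def G(1) by (meson less_trans)
      ultimately have "colourable (sp ` \<C>) (intersect_at_angle \<theta>) k"
        unfolding colourable_def by blast
      then show False using graph by (simp add: sparse_graph_def)
    qed
    then show "enat k \<le> x" using x by simp
  qed
  moreover have "\<forall>C \<in> sp ` \<C>. is_circle C" using pos by (auto simp: is_circle_def sp_def)
  moreover have "\<forall>C \<in> sp ` \<C>. \<forall>D \<in> sp ` \<C>. C \<noteq> D \<longrightarrow> \<not> concentric C D"
  proof (intro ballI impI)
    fix C D assume "C \<in> sp ` \<C>" "D \<in> sp ` \<C>" and ne: "C \<noteq> D"
    then obtain A B where AB: "A \<in> \<C>" "B \<in> \<C>" "C = sp A" "D = sp B" by blast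
    then have "fst A \<noteq> fst B" using inj_onD[OF inj, of A B] ne by blast
    then show "\<not> concentric C D" unfolding concentric_def using AB ctr by simp
  qed
  ultimately show ?thesis by blast
qed

end
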